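(* Let $\mathcal{M}=\{M^x:x\in\Lambda\}$ with $\Lambda=\mathbb{N}_{>0}$ be a standard log-convex weight matrix. Let $E,F$ be Banach spaces, $U\subseteq E$ open and $f:U\to F$ a smooth mapping. Then the following are equivalent: (1) $f$ is of class $\mathcal{E}_{\{\mathcal{M}\}}=\mathcal{E}^{\mathrm{b}}_{\{\mathcal{M}\}}$. (2) For each compact $K\subseteq U$, each $(r_k)_k\in\mathcal{R}_{\mathrm{Roum}}$ and each $(s_k)_k\in\tilde{\mathcal{S}}^{\mathcal{M}}_{\mathrm{Roum}}$ the set $$\left\{f^{(k)}(a)(v_1,\dots,v_k)r_ks_k:\ a\in K,\ k\in\mathbb{N},\ \|v_i\|_E\le 1\right\}$$ is bounded in $F$. (3) For each compact $K\subseteq U$, each $(r_k)_k\in\mathcal{R}_{\mathrm{Roum},\mathrm{sub}}$ and each $(s_k)_k\in\tilde{\mathcal{S}}^{\mathcal{M}}_{\mathrm{Roum},\mathrm{sub}}$ there exists $\varepsilon>0$ such that the set $$\left\{f^{(k)}(a)(v_1,\dots,v_k)r_ks_k\varepsilon^k:\ a\in K,\ k\in\mathbb{N},\ \|v_i\|_E\le 1\right\}$$ is bounded in $F$. If $\mathcal{M}$ is only assumed to be a weight matrix satisfying $(\mathcal{M})$ (with $\Lambda=\mathbb{N}_{>0}$), then the same equivalences hold with $\tilde{\mathcal{S}}^{\mathcal{M}}_{\mathrm{Roum},\mathrm{sub}}$ replaced by $\tilde{\mathcal{S}}^{\mathcal{M}}_{\mathrm{Roum}}$ in (3).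
   Context: Weight matrices. $\mathbb{N}=\{0,1,2,\dots\}$. A weight sequence $M=(M_k)_{k\in\mathbb{N}}$ is a sequence of positive reals; it is normalized if $1=M_0\le M_1$ and log-convex if $M_j^2\le M_{j-1}M_{j+1}$ for all $j\ge 1$. A family $\mathcal{M}=\{M^x:x\in\Lambda\}$ of weight sequences, $\Lambda=\mathbb{N}_{>0}$ with natural order, satisfies $(\mathcal{M})$ if each $M^x$ is normalized and increasing and $M^x_k\le M^y_k$ for all $k$ whenever $x\le y$. It is standard log-convex if in addition each $M^x$ is log-convex and $\lim_{k\to\infty}(M^x_k)^{1/k}=+\infty$. Sequence families (all sequences are sequences of positive reals normalized by $r_0=1$, $s_0=1$): $\mathcal{R}_{\mathrm{Roum}}$: all $(r_k)_k$ with $r_kt^k\to0$ as $k\to\infty$ for each $t>0$. $\mathcal{R}_{\mathrm{Roum},\mathrm{sub}}$: all $(r_k)_k\in\mathcal{R}_{\mathrm{Roum}}$ with $r_{j+k}\le r_jr_k$ for all $j,k\in\mathbb{N}$. $\tilde{\mathcal{S}}^{\mathcal{M}}_{\mathrm{Roum}}$: all $(s_k)_k$ such that for every $x\in\Lambda$ there is $C_x>0$ with $s_kM^x_k\le C_x^k$ for all $k$. $\tilde{\mathcal{S}}^{\mathcal{M}}_{\mathrm{Roum},\mathrm{sub}}$: all $(s_k)_k\in\tilde{\mathcal{S}}^{\mathcal{M}}_{\mathrm{Roum}}$ for which there is $D>0$ with $s_{j+k}\le D^{j+k}s_js_k$ for all $j,k\in\mathbb{N}$. Classes. For a closed absolutely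 convex bounded set $B\subseteq E$, $E_B$ is the linear span of $B$ normed by its Minkowski functional $\|\cdot\|_B$, $i_B:E_B\to E$ the inclusion, $U_B=i_B^{-1}(U)$. For $W$ open in a Banach space, $\mathcal{E}_{\{\mathcal{M}\}}(W,\mathbb{R})$ is the set of smooth $g:W\to\mathbb{R}$ such that for every compact $K\subseteq W$ there are $x\in\Lambda,h>0$ with $\sup_{k\in\mathbb{N},a\in K}\|g^{(k)}(a)\|/(h^kM^x_k)<\infty$. A smooth $f:U\to F$ is $\mathcal{E}_{\{\mathcal{M}\}}$ if $\alpha\circ f\circ i_B\in\mathcal{E}_{\{\mathcal{M}\}}(U_B,\mathbb{R})$ for all continuous linear functionals $\alpha$ on $F$ and all such $B$. It is $\mathcal{E}^{\mathrm{b}}_{\{\mathcal{M}\}}$ if for every such $B$ and every $K\subseteq U\cap E_B$ compact in $\|\cdot\|_B$ there are $x\in\Lambda,h>0$ such that $\{f^{(k)}(a)(v_1,\dots,v_k)/(h^kM^x_k):k\in\mathbb{N},a\in K,\|v_i\|_B\le1\}$ is bounded in $F$ (for Banach $E$ it suffices to take $B$ the closed unit ball). *)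

theory Defs
  imports "HOL-Analysis.Analysis"
begin

section \<open>Higher derivatives and smoothness\<close>

text \<open>
  The calculus below is relative to a normed space \<open>(V, p)\<close>, where \<open>V\<close> is a linear subspace of a
  real vector space and \<open>p\<close> a norm on \<open>V\<close>. A Banach space \<open>E\<close> given by a type is \<open>(UNIV, norm)\<close>;
  the spaces \<open>E\<^sub>B\<close> are \<open>(span B, minkowski B)\<close> and depend on \<open>B\<close>, so that they cannot be
  rendered as types.

  \<open>hderiv g [v\<^sub>1, \<dots>, v\<^sub>k] a\<close> is \<open>g\<^sup>(\<^sup>k\<^sup>)(a)(v\<^sub>1, \<dots>, v\<^sub>k)\<close>, obtained by iterated directional
  differentiation; it does not refer to a norm on the domain. That these are the Frechet
  derivatives with respect to \<open>p\<close> is part of the definition of \<open>smooth_wrt\<close>.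
\<close>

primrec hderiv ::
  "('a::real_vector \<Rightarrow> 'b::real_normed_vector) \<Rightarrow> 'a list \<Rightarrow> 'a \<Rightarrow> 'b" where
  "hderiv g [] a = g a"
| "hderiv g (v # vs) a = vector_derivative (\<lambda>t. hderiv g vs (a + t *\<^sub>R v)) (at 0)"

text \<open>\<open>k\<close>-linear maps on \<open>V\<close> are functions on lists of length \<open>k\<close>.\<close>

definition bounded_multilinear ::
  "'a::real_vector set \<Rightarrow> ('a \<Rightarrow> real) \<Rightarrow> nat \<Rightarrow> ('a list \<Rightarrow> 'b::real_normed_vector) \<Rightarrow> bool" where
  "bounded_multilinear V p k T \<longleftrightarrow>
    (\<forall>us ws x y. set (us @ ws) \<subseteq> V \<longrightarrow> length us + 1 + length ws = k \<longrightarrow> x \<in> V \<longrightarrow> y \<in> V \<longrightarrow>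
       T (us @ (x + y) # ws) = T (us @ x # ws) + T (us @ y # ws)) \<and>
    (\<forall>us ws x c. set (us @ ws) \<subseteq> V \<longrightarrow> length us + 1 + length ws = k \<longrightarrow> x \<in> V \<longrightarrow>
       T (us @ (c *\<^sub>R x) # ws) = c *\<^sub>R T (us @ x # ws)) \<and>
    (\<exists>C. \<forall>vs. set vs \<subseteq> V \<longrightarrow> length vs = k \<longrightarrow> norm (T vs) \<le> C * (\<Prod>v\<leftarrow>vs. p v))"

definition multi_norm ::
  "'a set \<Rightarrow> ('a \<Rightarrow> real) \<Rightarrow> nat \<Rightarrow> ('a list \<Rightarrow> 'b::real_normed_vector) \<Rightarrow> real" where
  "multi_norm V p k T = Sup {norm (T vs) | vs. length vs = k \<and> (\<forall>v\<in>set vs. v \<in> V \<and> p v \<le> 1)}"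

text \<open>
  \<open>g\<close> is smooth on \<open>W\<close> (open in \<open>(V, p)\<close>): for every \<open>k\<close>, the \<open>k\<close>-th derivative is a map from \<open>W\<close>
  into the bounded \<open>k\<close>-linear maps that is Frechet differentiable with respect to the operator
  norm, with derivative the \<open>(k+1)\<close>-st derivative.
\<close>

definition smooth_wrt ::
  "'a::real_vector set \<Rightarrow> ('a \<Rightarrow> real) \<Rightarrow> 'a set \<Rightarrow> ('a \<Rightarrow> 'b::real_normed_vector) \<Rightarrow> bool" where
  "smooth_wrt V p W g \<longleftrightarrow>
    (\<forall>k. \<forall>a\<in>W. bounded_multilinear V p k (\<lambda>vs. hderiv g vs a) \<and>
      (\<forall>\<epsilon>>0. \<exists>\<delta>>0. \<forall>y\<in>W. p (y - a) < \<delta> \<longrightarrow>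
         multi_norm V p k (\<lambda>vs. hderiv g vs y - hderiv g vs a - hderiv g ((y - a) # vs) a)
           \<le> \<epsilon> * p (y - a)))"

text \<open>The set of all \<open>w\<^sub>k g\<^sup>(\<^sup>k\<^sup>)(a)(v\<^sub>1, \<dots>, v\<^sub>k)\<close> with \<open>a \<in> K\<close>, \<open>k \<in> \<nat>\<close> and \<open>p(v\<^sub>i) \<le> 1\<close>.\<close>

definition weighted_derivs ::
  "'a::real_vector set \<Rightarrow> ('a \<Rightarrow> real) \<Rightarrow> ('a \<Rightarrow> 'b::real_normed_vector) \<Rightarrow> 'a set \<Rightarrow> (nat \<Rightarrow> real) \<Rightarrow> 'b set"
  where
  "weighted_derivs V p g K w =
    {w k *\<^sub>R hderiv g vs a | a k vs.
       a \<in> K \<and> length vs = k \<and> (\<forall>v\<in>set vs. v \<in> V \<and> p v \<le> 1)}"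

text \<open>For smooth maps on a Banach space these are the usual Frechet derivatives.\<close>

lemma hderiv_eq_has_derivative:
  fixes f :: "'a::real_normed_vector \<Rightarrow> 'b::real_normed_vector"
  assumes "(hderiv f vs has_derivative f') (at a)"
  shows "hderiv f (v # vs) a = f' v"
proof -
  have lin: "bounded_linear f'" using assms by (rule has_derivative_bounded_linear)
  have "((\<lambda>t::real. a + t *\<^sub>R v) has_derivative (\<lambda>t. t *\<^sub>R v)) (at 0)"
    by (auto intro!: derivative_eq_intros)
  moreover have "(hderiv f vs has_derivative f') (at (a + 0 *\<^sub>R v))" using assms by simp
  ultimately have "((\<lambda>t. hderiv f vs (a + t *\<^sub>R v)) has_derivative (\<lambda>t. f' (t *\<^sub>R v))) (at 0)"
    by (rule has_derivative_compose)
  then have "((\<lambda>t. hderiv f vs (a + t *\<^sub>R v)) has_vector_derivative f' v) (at 0)"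
    by (simp add: has_vector_derivative_def linear_simps(5)[OF lin])
  then show ?thesis by (simp add: vector_derivative_at)
qed

lemma bounded_multilinear_sgn:
  fixes T :: "'a::real_normed_vector list \<Rightarrow> 'b::real_normed_vector"
  assumes T: "bounded_multilinear UNIV norm k T" and "length us + length ws = k"
  shows "T (us @ ws) = (\<Prod>v\<leftarrow>ws. norm v) *\<^sub>R T (us @ map sgn ws)"
  using assms(2)
proof (induction ws arbitrary: us)
  case Nil
  then show ?case by simp
next
  case (Cons v ws)
  have v: "norm v *\<^sub>R sgn v = v" by (cases "v = 0") (auto simp: sgn_div_norm)
  have "\<forall>us ws x c. length us + 1 + length ws = k \<longrightarrow> T (us @ (c *\<^sub>R x) # ws) = c *\<^sub>R T (us @ x # ws)"
    using T unfolding bounded_multilinear_def by simp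
  then have "T (us @ (norm v *\<^sub>R sgn v) # ws) = norm v *\<^sub>R T (us @ sgn v # ws)"
    using Cons.prems by simp
  moreover have "T ((us @ [sgn v]) @ ws) = (\<Prod>v\<leftarrow>ws. norm v) *\<^sub>R T ((us @ [sgn v]) @ map sgn ws)"
    using Cons.prems by (intro Cons.IH) simp
  ultimately show ?case using v by simp
qed

lemma norm_le_multi_norm:
  fixes T :: "'a::real_normed_vector list \<Rightarrow> 'b::real_normed_vector"
  assumes T: "bounded_multilinear UNIV norm k T" and k: "length vs = k"
  shows "norm (T vs) \<le> multi_norm UNIV norm k T * (\<Prod>v\<leftarrow>vs. norm v)"
proof -
  obtain C where C: "\<And>vs. length vs = k \<Longrightarrow> norm (T vs) \<le> C * (\<Prod>v\<leftarrow>vs. norm v)"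
    using T unfolding bounded_multilinear_def by auto
  have le1: "0 \<le> (\<Prod>v\<leftarrow>vs. norm v) \<and> (\<Prod>v\<leftarrow>vs. norm v) \<le> 1" if "\<forall>v\<in>set vs. norm v \<le> 1"
    for vs :: "'a list" using that by (induction vs) (auto intro: mult_le_one)
  have "norm (T vs) \<le> \<bar>C\<bar>" if "length vs = k" "\<forall>v\<in>set vs. norm v \<le> 1" for vs
  proof -
    have "C * (\<Prod>v\<leftarrow>vs. norm v) \<le> \<bar>C\<bar> * 1"
      using le1[OF that(2)] by (intro mult_mono) auto
    then show ?thesis using C[OF that(1)] by simp
  qed
  then have bdd: "bdd_above {norm (T vs) | vs. length vs = k \<and> (\<forall>v\<in>set vs. v \<in> UNIV \<and> norm v \<le> 1)}"
    by (intro bdd_aboveI[of _ "\<bar>C\<bar>"]) auto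
  have "norm (T (map sgn vs)) \<le> multi_norm UNIV norm k T"
    unfolding multi_norm_def by (rule cSup_upper[OF _ bdd]) (use k in \<open>auto simp: norm_sgn intro!: exI[of _ "map sgn vs"]\<close>)
  moreover have "norm (T vs) = (\<Prod>v\<leftarrow>vs. norm v) * norm (T (map sgn vs))"
  proof -
    have "0 \<le> (\<Prod>v\<leftarrow>vs. norm v)" by (induction vs) auto
    then show ?thesis using bounded_multilinear_sgn[OF T, of "[]" vs] k by simp
  qed
  moreover have "0 \<le> (\<Prod>v\<leftarrow>vs. norm v)" by (induction vs) auto
  ultimately show ?thesis by (simp add: mult.commute mult_left_mono)
qed

lemma bounded_multilinear_diff:
  assumes "bounded_multilinear UNIV norm k S" "bounded_multilinear UNIV norm k T"
  shows "bounded_multilinear UNIV norm k (\<lambda>vs. S vs - T vs)"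
proof -
  obtain C D where C: "\<And>vs. length vs = k \<Longrightarrow> norm (S vs) \<le> C * (\<Prod>v\<leftarrow>vs. norm v)"
    and D: "\<And>vs. length vs = k \<Longrightarrow> norm (T vs) \<le> D * (\<Prod>v\<leftarrow>vs. norm v)"
    using assms unfolding bounded_multilinear_def by auto
  have "norm (S vs - T vs) \<le> (C + D) * (\<Prod>v\<leftarrow>vs. norm v)" if "length vs = k" for vs
    using norm_triangle_ineq4[of "S vs" "T vs"] C[OF that] D[OF that] by (simp add: distrib_right)
  then show ?thesis
    using assms unfolding bounded_multilinear_def
    by (auto simp: scaleR_diff_right)
qed

lemma bounded_multilinear_Cons:
  assumes T: "bounded_multilinear UNIV norm (Suc k) T"
  shows "bounded_multilinear UNIV norm k (\<lambda>vs. T (v # vs))"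
proof -
  obtain C where C: "\<And>vs. length vs = Suc k \<Longrightarrow> norm (T vs) \<le> C * (\<Prod>v\<leftarrow>vs. norm v)"
    using T unfolding bounded_multilinear_def by auto
  have "norm (T (v # vs)) \<le> (C * norm v) * (\<Prod>v\<leftarrow>vs. norm v)" if "length vs = k" for vs
    using C[of "v # vs"] that by (simp add: mult.assoc)
  moreover have
    "T (v # us @ (x + y) # ws) = T (v # us @ x # ws) + T (v # us @ y # ws)"
    "T (v # us @ (c *\<^sub>R x) # ws) = c *\<^sub>R T (v # us @ x # ws)"
    if "length us + 1 + length ws = k" for us ws x y c
  proof -
    have "\<forall>us ws x y. length us + 1 + length ws = Suc k \<longrightarrow>
        T (us @ (x + y) # ws) = T (us @ x # ws) + T (us @ y # ws)"
      "\<forall>us ws x c. length us + 1 + length ws = Suc k \<longrightarrow>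
        T (us @ (c *\<^sub>R x) # ws) = c *\<^sub>R T (us @ x # ws)"
      using T unfolding bounded_multilinear_def by simp_all
    from this[rule_format, of "v # us" ws] that
    show "T (v # us @ (x + y) # ws) = T (v # us @ x # ws) + T (v # us @ y # ws)"
      "T (v # us @ (c *\<^sub>R x) # ws) = c *\<^sub>R T (v # us @ x # ws)" by simp_all
  qed
  ultimately show ?thesis unfolding bounded_multilinear_def by auto
qed

lemma smooth_wrt_has_derivative:
  fixes f :: "'a::real_normed_vector \<Rightarrow> 'b::real_normed_vector"
  assumes f: "smooth_wrt UNIV norm U f" and "open U" "a \<in> U"
  shows "(hderiv f vs has_derivative (\<lambda>v. hderiv f (v # vs) a)) (at a)"
proof -
  define k where "k = length vs"
  define P where "P = (\<Prod>v\<leftarrow>vs. norm v)"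
  have P: "0 \<le> P" unfolding P_def by (induction vs) auto
  have ml: "bounded_multilinear UNIV norm j (\<lambda>vs. hderiv f vs x)" if "x \<in> U" for x j
    using f that unfolding smooth_wrt_def by blast
  have lin: "bounded_linear (\<lambda>v. hderiv f (v # vs) a)"
  proof -
    note m = ml[OF \<open>a \<in> U\<close>, of "Suc k", unfolded bounded_multilinear_def]
    obtain C where C: "\<And>vs. length vs = Suc k \<Longrightarrow> norm (hderiv f vs a) \<le> C * (\<Prod>v\<leftarrow>vs. norm v)"
      using m by auto
    show ?thesis
    proof (rule bounded_linear_intro)
      show "norm (hderiv f (v # vs) a) \<le> norm v * (C * P)" for v
        using C[of "v # vs"] by (simp add: P_def k_def mult_ac)
      show "hderiv f ((x + y) # vs) a = hderiv f (x # vs) a + hderiv f (y # vs) a" for x y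
        using m by (force simp: k_def simp del: hderiv.simps dest: spec[of _ "[]"])
      show "hderiv f ((c *\<^sub>R x) # vs) a = c *\<^sub>R hderiv f (x # vs) a" for c x
        using m by (force simp: k_def simp del: hderiv.simps dest: spec[of _ "[]"])
    qed
  qed
  have "\<exists>\<delta>>0. \<forall>y. norm (y - a) < \<delta> \<longrightarrow>
      norm (hderiv f vs y - hderiv f vs a - hderiv f ((y - a) # vs) a) \<le> e * norm (y - a)"
    if e: "0 < e" for e
  proof -
    define \<epsilon> where "\<epsilon> = e / (P + 1)"
    have \<epsilon>: "0 < \<epsilon>" "\<epsilon> * P \<le> e" using e P by (auto simp: \<epsilon>_def field_simps)
    obtain d where d: "0 < d" "\<And>y. y \<in> U \<Longrightarrow> norm (y - a) < d \<Longrightarrow>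
        multi_norm UNIV norm k (\<lambda>vs. hderiv f vs y - hderiv f vs a - hderiv f ((y - a) # vs) a)
          \<le> \<epsilon> * norm (y - a)"
      using f \<open>a \<in> U\<close> \<epsilon>(1) unfolding smooth_wrt_def by meson
    obtain d' where d': "0 < d'" "ball a d' \<subseteq> U"
      using \<open>open U\<close> \<open>a \<in> U\<close> open_contains_ball by blast
    show ?thesis
    proof (intro exI[of _ "min d d'"] conjI allI impI)
      fix y assume y: "norm (y - a) < min d d'"
      then have yU: "y \<in> U" using d'(2) by (auto simp: dist_norm norm_minus_commute)
      let ?T = "\<lambda>vs. hderiv f vs y - hderiv f vs a - hderiv f ((y - a) # vs) a"
      have "bounded_multilinear UNIV norm k ?T"
        by (intro bounded_multilinear_diff bounded_multilinear_Cons ml yU \<open>a \<in> U\<close>)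
      then have "norm (?T vs) \<le> multi_norm UNIV norm k ?T * P"
        unfolding P_def by (rule norm_le_multi_norm) (simp add: k_def)
      also have "\<dots> \<le> (\<epsilon> * norm (y - a)) * P"
        using d(2)[OF yU] y P by (intro mult_right_mono) auto
      also have "\<dots> = (\<epsilon> * P) * norm (y - a)" by simp
      also have "\<dots> \<le> e * norm (y - a)" using \<epsilon>(2) by (intro mult_right_mono) auto
      finally show "norm (?T vs) \<le> e * norm (y - a)" .
    qed (use d d' in auto)
  qed
  then show ?thesis using lin by (auto simp: has_derivative_at_alt simp del: hderiv.simps)
qed

section \<open>Weight matrices and sequence families\<close>

text \<open>A weight matrix is \<open>M :: nat \<Rightarrow> nat \<Rightarrow> real\<close> with \<open>M x k = M\<^sup>x\<^sub>k\<close>; only indices \<open>x > 0\<close> matter.\<close>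

definition weight_matrix :: "(nat \<Rightarrow> nat \<Rightarrow> real) \<Rightarrow> bool" where
  "weight_matrix M \<longleftrightarrow>
    (\<forall>x>0. (\<forall>k. 0 < M x k) \<and> M x 0 = 1 \<and> 1 \<le> M x 1 \<and> mono (M x)) \<and>
    (\<forall>x>0. \<forall>y>0. x \<le> y \<longrightarrow> (\<forall>k. M x k \<le> M y k))"

definition standard_log_convex :: "(nat \<Rightarrow> nat \<Rightarrow> real) \<Rightarrow> bool" where
  "standard_log_convex M \<longleftrightarrow> weight_matrix M \<and>
    (\<forall>x>0. (\<forall>j\<ge>1. (M x j)\<^sup>2 \<le> M x (j - 1) * M x (j + 1)) \<and>
           filterlim (\<lambda>k. root k (M x k)) at_top sequentially)"

definition R_roum :: "(nat \<Rightarrow> real) set" where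
  "R_roum = {r. (\<forall>k. 0 < r k) \<and> r 0 = 1 \<and> (\<forall>t>0. (\<lambda>k. r k * t ^ k) \<longlonglongrightarrow> 0)}"

definition R_roum_sub :: "(nat \<Rightarrow> real) set" where
  "R_roum_sub = {r \<in> R_roum. \<forall>j k. r (j + k) \<le> r j * r k}"

definition S_roum :: "(nat \<Rightarrow> nat \<Rightarrow> real) \<Rightarrow> (nat \<Rightarrow> real) set" where
  "S_roum M = {s. (\<forall>k. 0 < s k) \<and> s 0 = 1 \<and> (\<forall>x>0. \<exists>C>0. \<forall>k. s k * M x k \<le> C ^ k)}"

definition S_roum_sub :: "(nat \<Rightarrow> nat \<Rightarrow> real) \<Rightarrow> (nat \<Rightarrow> real) set" where
  "S_roum_sub M = {s \<in> S_roum M. \<exists>D>0. \<forall>j k. s (j + k) \<le> D ^ (j + k) * s j * s k}"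

section \<open>Ultradifferentiable classes of Roumieu type\<close>

text \<open>Nonemptiness excludes \<open>B = {}\<close>, for which the Minkowski functional would be an infimum over
  the empty set.\<close>

definition bounded_disk :: "'a::real_normed_vector set \<Rightarrow> bool" where
  "bounded_disk B \<longleftrightarrow> B \<noteq> {} \<and> closed B \<and> bounded B \<and> convex B \<and>
    (\<forall>v\<in>B. \<forall>c. \<bar>c\<bar> \<le> 1 \<longrightarrow> c *\<^sub>R v \<in> B)"

definition minkowski :: "'a::real_vector set \<Rightarrow> 'a \<Rightarrow> real" where
  "minkowski B v = Inf {t. 0 < t \<and> v \<in> (*\<^sub>R) t ` B}"

text \<open>The locale \<open>Metric_space\<close> requires nonnegativity and symmetry also outside the carrier, where
  \<open>p\<close> is arbitrary; hence the value 0 there.\<close>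

definition norm_dist :: "'a::real_vector set \<Rightarrow> ('a \<Rightarrow> real) \<Rightarrow> 'a \<Rightarrow> 'a \<Rightarrow> real" where
  "norm_dist V p x y = (if x \<in> V \<and> y \<in> V then p (x - y) else 0)"

definition norm_topology :: "'a::real_vector set \<Rightarrow> ('a \<Rightarrow> real) \<Rightarrow> 'a topology" where
  "norm_topology V p = Metric_space.mtopology V (norm_dist V p)"

lemma span_bounded_disk:
  assumes "bounded_disk B" "v \<in> span B"
  shows "\<exists>t>0. v \<in> (*\<^sub>R) t ` B"
proof -
  have bal: "c *\<^sub>R v \<in> B" if "v \<in> B" "\<bar>c\<bar> \<le> 1" for c v
    using assms(1) that by (auto simp: bounded_disk_def)
  have conv: "convex B" and ne: "B \<noteq> {}" using assms(1) by (auto simp: bounded_disk_def)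
  then have z: "0 \<in> B" using bal[of _ 0] by auto
  show ?thesis using assms(2)
  proof (induction rule: span_induct_alt)
    case base
    then show ?case using z by (auto intro!: exI[of _ 1])
  next
    case (step c x y)
    then obtain t b where t: "0 < t" "b \<in> B" "y = t *\<^sub>R b" by auto
    define u where "u = t + \<bar>c\<bar>"
    have u: "0 < u" using t by (simp add: u_def)
    have "sgn c *\<^sub>R x \<in> B" using step by (intro bal) (auto simp: sgn_real_def)
    then have "(\<bar>c\<bar> / u) *\<^sub>R (sgn c *\<^sub>R x) + (t / u) *\<^sub>R b \<in> B"
      using t u by (intro convexD[OF conv]) (auto simp: u_def simp flip: add_divide_distrib)
    moreover have "c *\<^sub>R x + y = u *\<^sub>R ((\<bar>c\<bar> / u) *\<^sub>R (sgn c *\<^sub>R x) + (t / u) *\<^sub>R b)"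
      using u by (simp add: scaleR_add_right t(3) abs_mult_sgn)
    ultimately show ?case using u by blast
  qed
qed

lemma minkowski_nonneg:
  assumes "bounded_disk B" "v \<in> span B"
  shows "0 \<le> minkowski B v"
  unfolding minkowski_def using span_bounded_disk[OF assms] by (intro cInf_greatest) auto

lemma minkowski_le:
  assumes "0 < t" "v \<in> (*\<^sub>R) t ` B"
  shows "minkowski B v \<le> t"
  unfolding minkowski_def using assms by (intro cInf_lower bdd_belowI[of _ 0]) auto

lemma minkowski_approx:
  assumes "bounded_disk B" "v \<in> span B" "0 < e"
  obtains t where "0 < t" "v \<in> (*\<^sub>R) t ` B" "t < minkowski B v + e"
proof -
  have "Inf {t. 0 < t \<and> v \<in> (*\<^sub>R) t ` B} < minkowski B v + e"
    using assms(3) by (simp add: minkowski_def)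
  then show ?thesis using cInf_lessD[of "{t. 0 < t \<and> v \<in> (*\<^sub>R) t ` B}"]
      span_bounded_disk[OF assms(1,2)] that by blast
qed

lemma norm_le_minkowski:
  fixes B :: "'a::real_normed_vector set"
  assumes "bounded_disk B"
  obtains C where "0 < C" "\<And>v. v \<in> span B \<Longrightarrow> norm v \<le> C * minkowski B v"
proof -
  obtain C where C: "0 < C" "\<And>b. b \<in> B \<Longrightarrow> norm b \<le> C"
    using assms by (auto simp: bounded_disk_def bounded_pos)
  have "norm v \<le> C * minkowski B v" if v: "v \<in> span B" for v
  proof (rule field_le_epsilon)
    fix e :: real assume "0 < e"
    then obtain t where t: "0 < t" "v \<in> (*\<^sub>R) t ` B" "t < minkowski B v + e / C"
      using minkowski_approx[OF assms v, of "e / C"] C(1) by auto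
    then have "norm v \<le> t * C" using C(2) by auto
    also have "\<dots> \<le> (minkowski B v + e / C) * C"
      using t(3) C(1) by (intro mult_right_mono) auto
    also have "\<dots> = C * minkowski B v + e" using C(1) by (simp add: field_simps)
    finally show "norm v \<le> C * minkowski B v + e" .
  qed
  then show ?thesis using C(1) that by blast
qed

lemma minkowski_triangle:
  assumes "bounded_disk B" "v \<in> span B" "w \<in> span B"
  shows "minkowski B (v + w) \<le> minkowski B v + minkowski B w"
proof (rule field_le_epsilon)
  fix e :: real assume e: "0 < e"
  obtain s where s: "0 < s" "v \<in> (*\<^sub>R) s ` B" "s < minkowski B v + e / 2"
    using minkowski_approx[OF assms(1,2), of "e / 2"] e by auto
  obtain t where t: "0 < t" "w \<in> (*\<^sub>R) t ` B" "t < minkowski B w + e / 2"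
    using minkowski_approx[OF assms(1,3), of "e / 2"] e by auto
  obtain b c where bc: "b \<in> B" "c \<in> B" "v = s *\<^sub>R b" "w = t *\<^sub>R c" using s t by auto
  have "(s / (s + t)) *\<^sub>R b + (t / (s + t)) *\<^sub>R c \<in> B"
    using assms(1) bc s t unfolding bounded_disk_def
    by (intro convexD[of B]) (auto simp flip: add_divide_distrib)
  moreover have "v + w = (s + t) *\<^sub>R ((s / (s + t)) *\<^sub>R b + (t / (s + t)) *\<^sub>R c)"
    using s t bc by (simp add: scaleR_add_right)
  ultimately have "v + w \<in> (*\<^sub>R) (s + t) ` B" by blast
  then show "minkowski B (v + w) \<le> minkowski B v + minkowski B w + e"
    using minkowski_le[of "s + t" "v + w" B] s t by auto
qed

lemma minkowski_minus:
  assumes "bounded_disk B"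
  shows "minkowski B (- v) = minkowski B v"
proof -
  have "- b \<in> B" if "b \<in> B" for b
    using assms that unfolding bounded_disk_def by (metis abs_neg_one order_refl scaleR_minus1_left)
  then have "- v \<in> (*\<^sub>R) t ` B" if "v \<in> (*\<^sub>R) t ` B" for t v
    using that by (metis (no_types, lifting) image_iff scaleR_minus_right)
  then have "{t. 0 < t \<and> - v \<in> (*\<^sub>R) t ` B} = {t. 0 < t \<and> v \<in> (*\<^sub>R) t ` B}"
    by (metis minus_minus)
  then show ?thesis by (simp add: minkowski_def)
qed

lemma minkowski_zero:
  assumes "bounded_disk B"
  shows "minkowski B 0 = 0"
proof (rule antisym)
  obtain b where "b \<in> B" using assms by (auto simp: bounded_disk_def)
  then have "0 *\<^sub>R b \<in> B" using assms abs_zero zero_le_one unfolding bounded_disk_def by metis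
  then have zero: "0 \<in> (*\<^sub>R) t ` B" for t by (intro image_eqI[of _ _ 0]) auto
  show "minkowski B 0 \<le> 0"
    by (rule field_le_epsilon) (use minkowski_le[OF _ zero] in simp)
  show "0 \<le> minkowski B 0" by (rule minkowski_nonneg[OF assms span_zero])
qed

lemma Metric_space_minkowski:
  fixes B :: "'a::real_normed_vector set"
  assumes B: "bounded_disk B"
  shows "Metric_space (span B) (norm_dist (span B) (minkowski B))"
proof
  fix x y z
  show "0 \<le> norm_dist (span B) (minkowski B) x y"
    by (simp add: norm_dist_def minkowski_nonneg[OF B] span_diff)
  show "norm_dist (span B) (minkowski B) x y = norm_dist (span B) (minkowski B) y x"
    using minkowski_minus[OF B, of "x - y"] by (simp add: norm_dist_def)
  assume x: "x \<in> span B" and y: "y \<in> span B"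
  obtain C where C: "0 < C" "\<And>v. v \<in> span B \<Longrightarrow> norm v \<le> C * minkowski B v"
    using norm_le_minkowski[OF B] by blast
  show "norm_dist (span B) (minkowski B) x y = 0 \<longleftrightarrow> x = y"
    using C(2)[of "x - y"] x y by (auto simp: norm_dist_def span_diff minkowski_zero[OF B])
  assume z: "z \<in> span B"
  show "norm_dist (span B) (minkowski B) x z
      \<le> norm_dist (span B) (minkowski B) x y + norm_dist (span B) (minkowski B) y z"
    using minkowski_triangle[OF B, of "x - y" "y - z"] x y z by (simp add: norm_dist_def span_diff)
qed

lemma minkowski_cball: "minkowski (cball 0 1) v = norm (v::'a::real_normed_vector)"
proof -
  have eq: "v \<in> (*\<^sub>R) t ` cball 0 1 \<longleftrightarrow> norm v \<le> t" if "0 < t" for t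
  proof
    assume "norm v \<le> t"
    then show "v \<in> (*\<^sub>R) t ` cball 0 1"
      using that by (intro image_eqI[of _ _ "v /\<^sub>R t"]) (auto simp: divide_simps)
  qed (use that in \<open>auto simp: mult_left_le\<close>)
  show ?thesis
  proof (rule antisym)
    show "minkowski (cball 0 1) v \<le> norm v"
    proof (rule field_le_epsilon)
      fix e :: real assume "0 < e"
      then show "minkowski (cball 0 1) v \<le> norm v + e"
        using eq[of "norm v + e"] by (intro minkowski_le) (auto simp: add_nonneg_pos)
    qed
    have "norm v + 1 \<in> {t. 0 < t \<and> v \<in> (*\<^sub>R) t ` cball 0 1}"
      using eq[of "norm v + 1"] by (simp add: add_nonneg_pos)
    then show "norm v \<le> minkowski (cball 0 1) v"
      unfolding minkowski_def using eq by (intro cInf_greatest) auto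
  qed
qed

text \<open>The class \<open>\<E>\<^sub>{\<^sub>M\<^sub>}(W, \<real>)\<close> for \<open>W\<close> open in the normed space \<open>(V, p)\<close>.\<close>

definition E_roum_real ::
  "(nat \<Rightarrow> nat \<Rightarrow> real) \<Rightarrow> 'a::real_vector set \<Rightarrow> ('a \<Rightarrow> real) \<Rightarrow> 'a set \<Rightarrow> ('a \<Rightarrow> real) set" where
  "E_roum_real M V p W = {g. smooth_wrt V p W g \<and>
    (\<forall>K. compactin (norm_topology V p) K \<and> K \<subseteq> W \<longrightarrow>
      (\<exists>x>0. \<exists>h>0. bdd_above
         {multi_norm V p k (\<lambda>vs. hderiv g vs a) / (h ^ k * M x k) | k a. a \<in> K}))}"

definition E_roum ::
  "(nat \<Rightarrow> nat \<Rightarrow> real) \<Rightarrow> 'a::real_normed_vector set \<Rightarrow> ('a \<Rightarrow> 'b::real_normed_vector) set" where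
  "E_roum M U = {f. smooth_wrt UNIV norm U f \<and>
    (\<forall>\<alpha> B. bounded_linear \<alpha> \<and> bounded_disk B \<longrightarrow>
      \<alpha> \<circ> f \<in> E_roum_real M (span B) (minkowski B) (U \<inter> span B))}"

definition Eb_roum ::
  "(nat \<Rightarrow> nat \<Rightarrow> real) \<Rightarrow> 'a::real_normed_vector set \<Rightarrow> ('a \<Rightarrow> 'b::real_normed_vector) set" where
  "Eb_roum M U = {f. smooth_wrt UNIV norm U f \<and>
    (\<forall>B K. bounded_disk B \<and>
       compactin (norm_topology (span B) (minkowski B)) K \<and> K \<subseteq> U \<inter> span B \<longrightarrow>
      (\<exists>x>0. \<exists>h>0. bounded
         (weighted_derivs (span B) (minkowski B) f K (\<lambda>k. 1 / (h ^ k * M x k)))))}"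

end

theory Submission
  imports Defs
begin

text \<open>
  Condition (2) is tested against continuous linear functionals: for a fixed functional, the constants
  \<open>x, h\<close> of the class \<open>\<E>\<^sub>{\<^sub>M\<^sub>}\<close> are absorbed by \<open>(s\<^sub>k)\<close> and \<open>(r\<^sub>k)\<close>, and weakly bounded sets are
  bounded. This removes the dependence of \<open>x, h\<close> on the functional. Conversely, if no pair \<open>x, h\<close> works
  on a compact set, a diagonal choice \<open>r\<^sub>k = \<phi>(k)\<^bsup>-k\<^esup>\<close>, \<open>s\<^sub>k = 1 / M\<^bsup>\<phi>(k)\<^esup>\<^sub>k\<close> with \<open>\<phi>\<close> growing slowly
  enough violates (3). Such \<open>r\<close> is always submultiplicative, and \<open>s\<close> is so when the \<open>M\<^sup>x\<close> are log-convex.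
\<close>

section \<open>Weakly bounded sets\<close>

definition sublinear :: "('a::real_vector \<Rightarrow> real) \<Rightarrow> bool" where
  "sublinear p \<longleftrightarrow>
    (\<forall>x y. p (x + y) \<le> p x + p y) \<and> (\<forall>c>0. \<forall>x. p (c *\<^sub>R x) \<le> c * p x)"

lemma sublinear_add: "sublinear p \<Longrightarrow> p (x + y) \<le> p x + p y"
  by (simp add: sublinear_def)

lemma sublinear_scale:
  assumes "sublinear p" "0 \<le> c"
  shows "p (c *\<^sub>R x) = c * p x"
proof (cases "c = 0")
  case True
  have le: "p (c *\<^sub>R x) \<le> c * p x" if "0 < c" for c x using assms that by (simp add: sublinear_def)
  have "p 0 = 0" using le[of 2 0] le[of "1/2" 0] by simp
  then show ?thesis using True by simp
next
  case False
  then have c: "0 < c" using assms by simp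
  have le: "p (c *\<^sub>R x) \<le> c * p x" if "0 < c" for c x using assms that by (simp add: sublinear_def)
  have "c * p x \<le> p (c *\<^sub>R x)"
    using le[of "inverse c" "c *\<^sub>R x"] c by (simp add: field_simps)
  then show ?thesis using le[OF c, of x] by simp
qed

lemma sublinear_ge: "sublinear p \<Longrightarrow> - p (- x) \<le> p x"
  using sublinear_add[of p x "- x"] sublinear_scale[of p 0 0] by simp

lemma sublinear_norm: "sublinear norm"
  by (simp add: sublinear_def norm_triangle_ineq)

text \<open>The witness is the infimum over t >= 0 of p(x + t y) - t p(y). This expression is
  sublinear in the pair (x, t) and bounded below by - p(- x), so its infimum in t is again
  sublinear. Testing the third property at t = 1 is what later forces additivity of a minimal
  functional, and a large value at y.\<close>

lemma sublinear_shift: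
  assumes p: "sublinear p"
  obtains q where "sublinear q" "\<And>x. q x \<le> p x" "\<And>x t. 0 \<le> t \<Longrightarrow> q x \<le> p (x + t *\<^sub>R y) - t * p y"
proof
  define g where "g x t = p (x + t *\<^sub>R y) - t * p y" for x t
  define q where "q x = Inf (g x ` {0..})" for x
  have "- p (- x) \<le> g x t" if "0 \<le> t" for x t
    using sublinear_add[OF p, of "x + t *\<^sub>R y" "- x"] sublinear_scale[OF p that, of y]
    by (simp add: g_def)
  then have bdd: "bdd_below (g x ` {0..})" for x by (intro bdd_belowI[of _ "- p (- x)"]) auto
  have le: "q x \<le> g x t" if "0 \<le> t" for x t
    unfolding q_def using that by (intro cInf_lower bdd) auto
  have ge: "c \<le> q x" if "\<And>t. 0 \<le> t \<Longrightarrow> c \<le> g x t" for c x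
    unfolding q_def using that by (intro cInf_greatest) auto
  show "q x \<le> p (x + t *\<^sub>R y) - t * p y" if "0 \<le> t" for x t
    using le[OF that] by (simp add: g_def)
  from this[of 0] show "q x \<le> p x" for x by simp
  show "sublinear q"
    unfolding sublinear_def
  proof (intro conjI allI impI)
    fix x z
    \<comment> \<open>The parameters s and t are independent, so the two infima are taken one after
      the other, each time with the other summand moved to the left.\<close>
    have "q (x + z) - g z t \<le> q x" if t: "0 \<le> t" for t
    proof (rule ge)
      fix s :: real assume s: "0 \<le> s"
      have "q (x + z) \<le> g (x + z) (s + t)" using s t by (intro le) simp
      also have "\<dots> \<le> g x s + g z t"
        using sublinear_add[OF p, of "x + s *\<^sub>R y" "z + t *\<^sub>R y"]
        by (simp add: g_def algebra_simps)
      finally show "q (x + z) - g z t \<le> g x s" by simp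
    qed
    then have "q (x + z) - q x \<le> q z" by (intro ge) (simp add: algebra_simps)
    then show "q (x + z) \<le> q x + q z" by simp
  next
    fix c :: real and x assume c: "0 < c"
    have "q (c *\<^sub>R x) / c \<le> q x"
    proof (rule ge)
      fix t :: real assume t: "0 \<le> t"
      \<comment> \<open>The parameter is scaled along with x, so that homogeneity of p pulls c out
        of the whole expression.\<close>
      have "q (c *\<^sub>R x) \<le> g (c *\<^sub>R x) (c * t)" using c t by (intro le) simp
      also have "\<dots> = c * g x t"
        using sublinear_scale[OF p, of c "x + t *\<^sub>R y"] c by (simp add: g_def algebra_simps)
      finally show "q (c *\<^sub>R x) / c \<le> g x t" using c by (simp add: field_simps)
    qed
    then show "q (c *\<^sub>R x) \<le> c * q x" using c by (simp add: field_simps)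
  qed
qed

text \<open>A minimal sublinear functional below \<open>p\<close> is linear, since by minimality it equals each of its
  shifts in the sense of the preceding lemma.\<close>

lemma linear_below_sublinear:
  assumes p: "sublinear p"
  obtains l where "linear l" "\<And>x. l x \<le> p x"
proof -
  define A where "A = {q. sublinear q \<and> (\<forall>x. q x \<le> p x)}"
  have "\<exists>m\<in>A. \<forall>q\<in>A. (\<forall>x. q x \<le> m x) \<longrightarrow> q = m"
  proof (rule predicate_Zorn)
    \<comment> \<open>The order is the reversed pointwise one: the maximal element provided by
      Zorn's lemma is a minimal sublinear functional, and upper bounds of chains are pointwise
      infima.\<close>
    show "partial_order_on A (relation_of (\<lambda>a b. \<forall>x. b x \<le> a x) A)"
      by (rule partial_order_on_relation_ofI) (auto intro: order_trans intro!: ext antisym)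
  next
    fix C assume "C \<in> Chains (relation_of (\<lambda>a b. \<forall>x. b x \<le> a x) A)"
    then have CA: "C \<subseteq> A" and chain: "\<And>a b. a \<in> C \<Longrightarrow> b \<in> C \<Longrightarrow> (\<forall>x. b x \<le> a x) \<or> (\<forall>x. a x \<le> b x)"
      unfolding Chains_def relation_of_def by auto
    show "\<exists>u\<in>A. \<forall>a\<in>C. \<forall>x. u x \<le> a x"
    proof (cases "C = {}")
      case True
      then show ?thesis using p by (auto simp: A_def)
    next
      case False
      define u where "u x = (INF q\<in>C. q x)" for x
      have "- p (- x) \<le> q x" if "q \<in> C" for q x
      proof -
        have "sublinear q" "q (- x) \<le> p (- x)" using that CA by (auto simp: A_def)
        then show ?thesis using sublinear_ge[of q x] by simp
      qed
      then have le: "u x \<le> q x" if "q \<in> C" for q x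
        unfolding u_def using that by (intro cINF_lower bdd_belowI2[of _ "- p (- x)"])
      have ge: "c \<le> u x" if "\<And>q. q \<in> C \<Longrightarrow> c \<le> q x" for c x
        unfolding u_def using that False by (intro cINF_greatest)
      have sub: "sublinear q" if "q \<in> C" for q using that CA by (auto simp: A_def)
      have "sublinear u"
        unfolding sublinear_def
      proof (intro conjI allI impI)
        fix x y
        \<comment> \<open>Of two members of the chain one lies below the other; subadditivity of the
          lower one bounds u(x + y) by a x + b y.\<close>
        have "u (x + y) \<le> a x + b y" if "a \<in> C" "b \<in> C" for a b
          using chain[OF that] le[OF that(1), of "x + y"] le[OF that(2), of "x + y"]
            sublinear_add[OF sub[OF that(1)], of x y] sublinear_add[OF sub[OF that(2)], of x y]
          by (smt (verit))
        then have "u (x + y) - b y \<le> u x" if "b \<in> C" for b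
          using that by (intro ge) (simp add: algebra_simps)
        then have "u (x + y) - u x \<le> u y" by (intro ge) (simp add: algebra_simps)
        then show "u (x + y) \<le> u x + u y" by simp
      next
        fix c :: real and x assume c: "0 < c"
        have "u (c *\<^sub>R x) / c \<le> u x"
        proof (rule ge)
          fix q assume "q \<in> C"
          then show "u (c *\<^sub>R x) / c \<le> q x"
            using le[of q "c *\<^sub>R x"] sublinear_scale[OF sub, of q c x] c by (simp add: field_simps)
        qed
        then show "u (c *\<^sub>R x) \<le> c * u x" using c by (simp add: field_simps)
      qed
      moreover have "u x \<le> p x" for x
      proof -
        obtain q where "q \<in> C" using False by blast
        moreover have "q x \<le> p x" using \<open>q \<in> C\<close> CA by (auto simp: A_def)
        ultimately show ?thesis using le[of q x] by simp
      qed
      ultimately show ?thesis using le by (auto simp: A_def)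
    qed
  qed
  then obtain m where "m \<in> A" and least: "\<And>q. q \<in> A \<Longrightarrow> (\<forall>x. q x \<le> m x) \<Longrightarrow> q = m"
    by blast
  then have m: "sublinear m" "\<And>x. m x \<le> p x" by (auto simp: A_def)
  have min: "q = m" if "sublinear q" "\<And>x. q x \<le> m x" for q
    using that m(2) by (intro least) (auto simp: A_def intro: order_trans[OF that(2)])
  have add: "m (x + y) = m x + m y" for x y
  proof -
    obtain q where q: "sublinear q" "\<And>x. q x \<le> m x" "\<And>x t. 0 \<le> t \<Longrightarrow> q x \<le> m (x + t *\<^sub>R y) - t * m y"
      using sublinear_shift[OF m(1)] by blast
    then have "q = m" using min by blast
    then show ?thesis using q(3)[of 1 x] sublinear_add[OF m(1), of x y] by simp
  qed
  have "m 0 = 0" using add[of 0 0] by simp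
  then have neg: "m (- x) = - m x" for x using add[of x "- x"] by simp
  \<comment> \<open>Sublinearity yields homogeneity for c >= 0 only; negative c are reduced to this
    case by oddness, which follows from additivity.\<close>
  have "m (c *\<^sub>R x) = c *\<^sub>R m x" for c x
    using sublinear_scale[OF m(1), of c x] sublinear_scale[OF m(1), of "- c" x] neg[of "c *\<^sub>R x"]
    by (cases "0 \<le> c") auto
  then have "linear m" using add by (intro linearI)
  then show ?thesis using m(2) that by blast
qed

text \<open>The norm is shifted along y before a linear functional is chosen below it. At - y with t
  = 1 the shift is at most norm 0 - norm y, hence l(- y) <= - norm y, and l y cannot be smaller than
  norm y.\<close>

lemma norming_functional:
  fixes y :: "'a::real_normed_vector"
  obtains l where "bounded_linear l" "\<And>x. \<bar>l x\<bar> \<le> norm x" "l y = norm y"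
proof -
  obtain q where q: "sublinear q" "\<And>x::'a. q x \<le> norm x"
      "\<And>x t. 0 \<le> t \<Longrightarrow> q x \<le> norm (x + t *\<^sub>R y) - t * norm y"
    using sublinear_shift[OF sublinear_norm] by blast
  obtain l where l: "linear l" "\<And>x. l x \<le> q x" using linear_below_sublinear[OF q(1)] by blast
  have le: "l x \<le> norm x" for x using l(2) q(2) order_trans by blast
  have abs: "\<bar>l x\<bar> \<le> norm x" for x using le[of x] le[of "- x"] linear_neg[OF l(1), of x] by simp
  have "bounded_linear l"
    using l(1) abs by (intro bounded_linear_intro[of _ 1]) (auto simp: linear_add linear_scale)
  moreover have "l y = norm y"
    using q(3)[of 1 "- y"] l(2)[of "- y"] linear_neg[OF l(1), of y] le[of y] by simp
  ultimately show ?thesis using abs that by blast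
qed

text \<open>Baire's theorem in the dual space; no completeness of the space itself is involved.\<close>

lemma weakly_bounded_imp_bounded:
  fixes S :: "'a::real_normed_vector set"
  assumes wb: "\<And>l :: 'a \<Rightarrow> real. bounded_linear l \<Longrightarrow> bounded (l ` S)"
  shows "bounded S"
proof -
  define A :: "nat \<Rightarrow> ('a \<Rightarrow>\<^sub>L real) set" where "A n = {l. \<forall>y\<in>S. \<bar>blinfun_apply l y\<bar> \<le> real n}" for n
  have "closed (A n)" for n
  proof -
    have "A n = (\<Inter>y\<in>S. {l. \<bar>blinfun_apply l y\<bar> \<le> real n})" by (auto simp: A_def)
    then show ?thesis by (auto intro!: closed_INT closed_Collect_le continuous_intros)
  qed
  moreover have "(\<Union>n. A n) = UNIV"
  proof -
    have "\<exists>n. l \<in> A n" for l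
    proof -
      have "bounded (blinfun_apply l ` S)" by (intro wb blinfun.bounded_linear_right)
      then obtain b where "\<And>y. y \<in> S \<Longrightarrow> \<bar>blinfun_apply l y\<bar> \<le> b" by (auto simp: bounded_iff)
      moreover obtain n where "b \<le> real n" using real_arch_simple by blast
      ultimately show ?thesis by (auto simp: A_def intro: order_trans)
    qed
    then show ?thesis by blast
  qed
  ultimately obtain n where "interior (A n) \<noteq> {}"
    \<comment> \<open>The dual is complete and is a countable union of the closed sets
      \<open>A n\<close>, so one of them has an interior point.\<close>
    using Baire_category_alt[of "euclidean :: ('a \<Rightarrow>\<^sub>L real) topology" "range A"]
    by (auto simp: completely_metrizable_space_euclidean)
  then obtain l0 e where e: "0 < e" "cball l0 e \<subseteq> A n"
    by (metis all_not_in_conv mem_interior_cball)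
  have "norm y \<le> 2 * real n / e" if y: "y \<in> S" for y
  proof -
    obtain k where k: "bounded_linear k" "\<And>x. \<bar>k x\<bar> \<le> norm x" "k y = norm y"
      using norming_functional by blast
    define l where "l = Blinfun k"
    have app: "blinfun_apply l = k" using k(1) by (simp add: l_def bounded_linear_Blinfun_apply)
    \<comment> \<open>Since l has norm at most 1, both l0 and l0 + e l lie in the ball. Their values
      at y differ by e * norm y, and both are bounded by n in absolute value.\<close>
    have "norm l \<le> 1" using k(2) by (intro norm_blinfun_bound) (auto simp: app)
    then have "l0 + e *\<^sub>R l \<in> A n" "l0 \<in> A n"
      using e by (auto simp: subset_iff dist_norm mult_left_le)
    then have "\<bar>l0 y + e * norm y\<bar> \<le> n" "\<bar>l0 y\<bar> \<le> n"
      using y by (auto simp: A_def app k(3) blinfun.add_left blinfun.scaleR_left)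
    then have "e * norm y \<le> 2 * real n" by linarith
    then show ?thesis using e(1) by (simp add: field_simps)
  qed
  then show ?thesis by (auto simp: bounded_iff)
qed

section \<open>Weight matrices and diagonal sequences\<close>

lemma weight_pos: "weight_matrix M \<Longrightarrow> 0 < x \<Longrightarrow> 0 < M x k"
  and weight_0: "weight_matrix M \<Longrightarrow> 0 < x \<Longrightarrow> M x 0 = 1"
  and weight_mono: "weight_matrix M \<Longrightarrow> 0 < x \<Longrightarrow> x \<le> y \<Longrightarrow> M x k \<le> M y k"
  by (auto simp: weight_matrix_def)

text \<open>Log-convexity says that the quotients q i = m(i+1) / m(i) increase. Passing from k to k
  + 1 multiplies the left side by q k and the right side by the larger q(j + k).\<close>

lemma log_convex_mult_le:
  fixes m :: "nat \<Rightarrow> real"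
  assumes pos: "\<And>k. 0 < m k" and "m 0 = 1" and lc: "\<And>j. 1 \<le> j \<Longrightarrow> (m j)\<^sup>2 \<le> m (j - 1) * m (j + 1)"
  shows "m j * m k \<le> m (j + k)"
proof -
  define q where "q i = m (Suc i) / m i" for i
  have "q i \<le> q (Suc i)" for i
    using lc[of "Suc i"] pos[of i] pos[of "Suc i"]
    by (simp add: q_def field_simps power2_eq_square)
  then have q: "q i \<le> q j" if "i \<le> j" for i j by (rule lift_Suc_mono_le[OF _ that])
  show ?thesis
  proof (induction k)
    case 0
    then show ?case using assms(2) by simp
  next
    case (Suc k)
    have "m j * m (Suc k) = (m j * m k) * q k" using pos[of k] by (simp add: q_def)
    also have "\<dots> \<le> m (j + k) * q (j + k)"
      using Suc q[of k "j + k"] pos[of "j + k"] pos[of k] pos[of "Suc k"]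
      by (intro mult_mono) (auto simp: q_def less_imp_le)
    also have "\<dots> = m (j + Suc k)" using pos[of "j + k"] by (simp add: q_def)
    finally show ?case .
  qed
qed

text \<open>The product with t^k is (t / \<phi>(k))^k, eventually at most 2^(-k).
  Submultiplicativity holds because \<phi>(j + k) is at least \<phi>(j) and \<phi>(k), so each of
  the j + k factors can be compared separately.\<close>

lemma inverse_power_in_R_roum_sub:
  fixes \<phi> :: "nat \<Rightarrow> nat"
  assumes mono: "mono \<phi>" and pos: "\<And>k. 0 < \<phi> k" and lim: "filterlim \<phi> at_top sequentially"
  shows "(\<lambda>k. inverse (real (\<phi> k)) ^ k) \<in> R_roum_sub"
proof -
  have "(\<lambda>k. inverse (real (\<phi> k)) ^ k * t ^ k) \<longlonglongrightarrow> 0" if t: "0 < t" for t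
  proof (rule tendsto_sandwich[of "\<lambda>_. 0"])
    obtain n where n: "2 * t \<le> real n" using real_arch_simple by blast
    have "\<forall>\<^sub>F k in sequentially. n \<le> \<phi> k" using lim by (simp add: filterlim_at_top)
    then show "\<forall>\<^sub>F k in sequentially. inverse (real (\<phi> k)) ^ k * t ^ k \<le> (1 / 2) ^ k"
    proof eventually_elim
      case (elim k)
      have "2 * t \<le> real (\<phi> k)" using n elim by simp
      then have "inverse (real (\<phi> k)) * t \<le> 1 / 2" using pos[of k] by (simp add: field_simps)
      then show ?case using t unfolding power_mult_distrib[symmetric] by (intro power_mono) auto
    qed
    show "(\<lambda>k. (1 / 2 :: real) ^ k) \<longlonglongrightarrow> 0" by (rule LIMSEQ_realpow_zero) auto
  qed (use t in auto)
  moreover have "inverse (real (\<phi> (j + k))) ^ (j + k)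
      \<le> inverse (real (\<phi> j)) ^ j * inverse (real (\<phi> k)) ^ k" for j k
    unfolding power_add
    using pos[of j] pos[of k] monoD[OF mono, of j "j + k"] monoD[OF mono, of k "j + k"]
    by (intro mult_mono power_mono le_imp_inverse_le) auto
  ultimately show ?thesis using pos by (auto simp: R_roum_sub_def R_roum_def)
qed

text \<open>For fixed x, the weight M x k is dominated by M (\<phi> k) k as soon as \<phi>(k) >= x.
  Only finitely many k remain, and the constant absorbs them.\<close>

lemma diagonal_in_S_roum:
  fixes \<phi> :: "nat \<Rightarrow> nat"
  assumes M: "weight_matrix M" and pos: "\<And>k. 0 < \<phi> k" and lim: "filterlim \<phi> at_top sequentially"
  shows "(\<lambda>k. 1 / M (\<phi> k) k) \<in> S_roum M"
proof -
  have "\<exists>C>0. \<forall>k. 1 / M (\<phi> k) k * M x k \<le> C ^ k" if x: "0 < x" for x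
  proof -
    define u where "u k = 1 / M (\<phi> k) k * M x k" for k
    have u: "0 \<le> u k" for k using weight_pos[OF M x, of k] weight_pos[OF M pos[of k], of k] by (simp add: u_def)
    obtain n where n: "\<And>k. n \<le> k \<Longrightarrow> x \<le> \<phi> k"
      using lim by (auto simp: filterlim_at_top eventually_sequentially)
    \<comment> \<open>The sum dominates the finitely many exceptional values; the summand 1 makes C
      at least 1, so that C <= C^k for k > 0.\<close>
    define C where "C = 1 + (\<Sum>k<n. u k)"
    have C1: "1 \<le> C" using u by (simp add: C_def sum_nonneg)
    have "u k \<le> C ^ k" for k
    proof (cases "n \<le> k")
      case True
      have "u k \<le> 1"
        using weight_mono[OF M x n[OF True], of k] weight_pos[OF M pos[of k], of k] by (simp add: u_def)
      then show ?thesis using one_le_power[OF C1, of k] by simp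
    next
      case False
      show ?thesis
      \<comment> \<open>At k = 0 the bound C^0 = 1 leaves no room for a constant, and the
        normalization of the weights at 0 is used instead.\<close>
      proof (cases "k = 0")
        case True
        then show ?thesis using weight_0[OF M] x pos[of 0] by (simp add: u_def)
      next
        case k: False
        have "u k \<le> (\<Sum>k<n. u k)" using False u by (intro member_le_sum) auto
        then have "u k \<le> C" by (simp add: C_def)
        also have "C \<le> C ^ k" using C1 k by (intro self_le_power) auto
        finally show ?thesis .
      qed
    qed
    then show ?thesis using C1 unfolding u_def by (intro exI[of _ C]) auto
  qed
  then show ?thesis using weight_pos[OF M pos] weight_0[OF M pos] by (simp add: S_roum_def)
qed

text \<open>The constant D = 1 suffices: both indices \<phi>(j) and \<phi>(k) are raised to \<phi>(j
  + k), after which a single log-convex sequence is involved.\<close>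

lemma diagonal_in_S_roum_sub:
  fixes \<phi> :: "nat \<Rightarrow> nat"
  assumes M: "standard_log_convex M"
    and mono: "mono \<phi>" and pos: "\<And>k. 0 < \<phi> k" and lim: "filterlim \<phi> at_top sequentially"
  shows "(\<lambda>k. 1 / M (\<phi> k) k) \<in> S_roum_sub M"
proof -
  have W: "weight_matrix M" using M by (simp add: standard_log_convex_def)
  have "1 / M (\<phi> (j + k)) (j + k) \<le> 1 ^ (j + k) * (1 / M (\<phi> j) j) * (1 / M (\<phi> k) k)" for j k
  proof -
    have "M (\<phi> j) j * M (\<phi> k) k \<le> M (\<phi> (j + k)) j * M (\<phi> (j + k)) k"
      using weight_pos[OF W pos] by (intro mult_mono weight_mono[OF W] pos monoD[OF mono]) (auto simp: less_imp_le)
    also have "\<dots> \<le> M (\<phi> (j + k)) (j + k)"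
      using M pos weight_pos[OF W pos] weight_0[OF W pos]
      by (intro log_convex_mult_le) (auto simp: standard_log_convex_def)
    finally show ?thesis
      using weight_pos[OF W pos[of j], of j] weight_pos[OF W pos[of k], of k]
      by (simp add: frac_le)
  qed
  then show ?thesis using diagonal_in_S_roum[OF W pos lim] zero_less_one unfolding S_roum_sub_def by blast
qed

section \<open>Passing between the weights h^k M x k and the sequence families\<close>

definition weighted_bounded :: "(nat \<Rightarrow> real set) \<Rightarrow> (nat \<Rightarrow> real) \<Rightarrow> bool" where
  "weighted_bounded N w \<longleftrightarrow> (\<exists>B. \<forall>k. \<forall>y\<in>N k. w k * y \<le> B)"

text \<open>Membership of s turns M x k into C^k at the cost of s k. What is left is r k (h C)^k, a
  null sequence and therefore bounded.\<close>

lemma weighted_bounded_R_S: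
  assumes M: "weight_matrix M" and x: "0 < x" "0 < h"
    and N: "weighted_bounded N (\<lambda>k. 1 / (h ^ k * M x k))"
    and r: "r \<in> R_roum" and s: "s \<in> S_roum M"
  shows "weighted_bounded N (\<lambda>k. r k * s k)"
proof -
  obtain B where B: "\<And>k y. y \<in> N k \<Longrightarrow> 1 / (h ^ k * M x k) * y \<le> B"
    using N by (auto simp: weighted_bounded_def)
  obtain C where C: "0 < C" "\<And>k. s k * M x k \<le> C ^ k"
    using s x unfolding S_roum_def by blast
  have r0: "0 < r k" for k using r by (auto simp: R_roum_def)
  have s0: "0 < s k" for k using s by (auto simp: S_roum_def)
  have "(\<lambda>k. r k * (h * C) ^ k) \<longlonglongrightarrow> 0" using r x C by (auto simp: R_roum_def)
  then have "Bseq (\<lambda>k. r k * (h * C) ^ k)" using convergent_imp_Bseq convergent_def by blast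
  then obtain R where R: "\<And>k. norm (r k * (h * C) ^ k) \<le> R" unfolding Bseq_def by blast
  have "r k * s k * y \<le> \<bar>B\<bar> * R" if y: "y \<in> N k" for k y
  proof -
    have Mp: "0 < M x k" using weight_pos[OF M x(1)] .
    have "y \<le> B * (h ^ k * M x k)" using B[OF y] Mp x by (simp add: field_simps)
    also have "\<dots> \<le> \<bar>B\<bar> * (h ^ k * M x k)" using Mp x by (intro mult_right_mono) auto
    finally have "r k * s k * y \<le> r k * s k * (\<bar>B\<bar> * (h ^ k * M x k))"
      using r0[of k] s0[of k] by (intro mult_left_mono) auto
    also have "\<dots> = (\<bar>B\<bar> * r k * h ^ k) * (s k * M x k)" by (simp add: mult_ac)
    also have "\<dots> \<le> (\<bar>B\<bar> * r k * h ^ k) * C ^ k"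
      using C x r0[of k] by (intro mult_left_mono) auto
    also have "\<dots> = \<bar>B\<bar> * (r k * (h * C) ^ k)" by (simp add: power_mult_distrib)
    also have "\<dots> \<le> \<bar>B\<bar> * R" using R[of k] by (intro mult_left_mono) auto
    finally show ?thesis .
  qed
  then show ?thesis by (auto simp: weighted_bounded_def)
qed

text \<open>If no pair \<open>(x, h)\<close> works, there are \<open>k\<^sub>1 < k\<^sub>2 < \<dots>\<close> at which \<open>N k\<^sub>n\<close> exceeds
  \<open>n n\<^bsup>2k\<^sub>n\<^esup> M\<^sup>n\<^sub>k\<^sub>n\<close>; then \<open>r\<^sub>k = \<phi>(k)\<^bsup>-k\<^esup>\<close> and \<open>s\<^sub>k = 1 / M\<^bsup>\<phi>(k)\<^esup>\<^sub>k\<close> with \<open>\<phi>(k\<^sub>n) = n\<close> violate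
  the hypothesis, for every \<open>\<epsilon>\<close>.\<close>

lemma weighted_bounded_of_R_S:
  assumes M: "weight_matrix M"
    and S: "\<And>\<phi>. mono \<phi> \<Longrightarrow> (\<And>k. 0 < \<phi> k) \<Longrightarrow> filterlim \<phi> at_top sequentially \<Longrightarrow>
      (\<lambda>k. 1 / M (\<phi> k) k) \<in> S"
    and N: "\<And>r s. r \<in> R_roum_sub \<Longrightarrow> s \<in> S \<Longrightarrow>
      \<exists>\<epsilon>>0. weighted_bounded N (\<lambda>k. r k * s k * \<epsilon> ^ k)"
  shows "\<exists>x>0. \<exists>h>0. weighted_bounded N (\<lambda>k. 1 / (h ^ k * M x k))"
proof (rule ccontr)
  assume neg: "\<not> ?thesis"
  have diag: "\<exists>\<epsilon>>0. \<exists>B. \<forall>k. \<forall>y\<in>N k.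
      inverse (real (\<phi> k)) ^ k * (1 / M (\<phi> k) k) * \<epsilon> ^ k * y \<le> B"
    if "mono \<phi>" "\<And>k. 0 < \<phi> k" "filterlim \<phi> at_top sequentially" for \<phi>
    using N[OF inverse_power_in_R_roum_sub[OF that] S[OF that]] by (simp add: weighted_bounded_def)
  \<comment> \<open>Every single N k is bounded above: the hypothesis for \<phi> =
    \<open>Suc\<close> is read off at one k. This is what pushes the violations below to arbitrarily
    large k.\<close>
  have "\<exists>c. \<forall>y\<in>N k. y \<le> c" for k
  proof -
    obtain \<epsilon> B where e: "0 < \<epsilon>"
      and B: "\<And>y. y \<in> N k \<Longrightarrow> inverse (real (Suc k)) ^ k * (1 / M (Suc k) k) * \<epsilon> ^ k * y \<le> B"
      using diag[OF mono_Suc _ filterlim_Suc] by auto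
    define w where "w = inverse (real (Suc k)) ^ k * (1 / M (Suc k) k) * \<epsilon> ^ k"
    have "0 < w" using e weight_pos[OF M, of "Suc k" k] unfolding w_def by simp
    moreover have "w * y \<le> B" if "y \<in> N k" for y unfolding w_def using B[OF that] .
    ultimately have "y \<le> B / w" if "y \<in> N k" for y using that by (simp add: pos_le_divide_eq mult.commute[of _ w])
    then show ?thesis by blast
  qed
  then obtain c where c: "\<And>k y. y \<in> N k \<Longrightarrow> y \<le> c k" by metis
  \<comment> \<open>With a = n + 1, one power a^k will cancel r k and M (Suc n) k will cancel s k.
    The second a^k is kept to beat \<epsilon>^k, and the leading a to beat the bound B. The shift by
    one keeps all matrix indices positive.\<close>
  define P where "P n k \<longleftrightarrow> (\<exists>y\<in>N k. real (Suc n) * (real (Suc n) ^ k * real (Suc n) ^ k * M (Suc n) k) < y)" for n k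
  have large: "\<exists>k>k0. P n k" for n k0
  proof -
    define h where "h = real (Suc n) * real (Suc n)"
    define w where "w k = h ^ k * M (Suc n) k" for k
    have h: "0 < h" by (simp add: h_def)
    have w: "0 < w k" for k using h weight_pos[OF M, of "Suc n" k] by (simp add: w_def)
    \<comment> \<open>The sum exceeds every weighted value with index at most k0, so a violation of
      B must occur beyond k0; the summand n + 1 supplies the leading factor in
      \<open>P\<close>.\<close>
    define B where "B = real (Suc n) + (\<Sum>j\<le>k0. \<bar>c j\<bar> / w j)"
    have sum0: "0 \<le> (\<Sum>j\<le>k0. \<bar>c j\<bar> / w j)" using w by (intro sum_nonneg) (simp add: less_imp_le)
    have "\<not> weighted_bounded N (\<lambda>k. 1 / w k)" using neg h unfolding w_def by blast
    then obtain k y where k: "y \<in> N k" "B < 1 / w k * y" unfolding weighted_bounded_def by (meson not_le)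
    have "k0 < k"
    proof (rule ccontr)
      assume "\<not> k0 < k"
      then have "\<bar>c k\<bar> / w k \<le> (\<Sum>j\<le>k0. \<bar>c j\<bar> / w j)"
        using w by (intro member_le_sum) (auto simp: less_imp_le)
      moreover have "1 / w k * y \<le> \<bar>c k\<bar> / w k"
        using c[OF k(1)] w[of k] by (simp add: divide_right_mono)
      ultimately show False using k(2) by (simp add: B_def)
    qed
    moreover have "real (Suc n) < 1 / w k * y" using k(2) sum0 by (simp add: B_def)
    then have "real (Suc n) * w k < y" using w[of k] by (simp add: field_simps)
    then have "P n k" using k(1) unfolding P_def w_def h_def power_mult_distrib by blast
    ultimately show ?thesis by blast
  qed
  have "\<exists>\<kappa>. \<forall>n. P n (\<kappa> n) \<and> \<kappa> n < \<kappa> (Suc n)"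
    by (rule dependent_nat_choice) (use large in blast)+
  then obtain \<kappa> where \<kappa>: "\<And>n. P n (\<kappa> n)" "strict_mono \<kappa>"
    by (auto simp: strict_mono_Suc_iff)
  \<comment> \<open>This is the slowest choice: a step function with value n + 1 after \<kappa>(n -
    1) up to and including \<kappa>(n).\<close>
  define \<phi> where "\<phi> k = Suc (LEAST n. k \<le> \<kappa> n)" for k
  have ex: "k \<le> \<kappa> k" for k using \<kappa>(2) by (rule strict_mono_imp_increasing)
  have \<phi>\<kappa>: "\<phi> (\<kappa> n) = Suc n" for n
    unfolding \<phi>_def by (simp add: strict_mono_less_eq[OF \<kappa>(2)] Least_equality)
  have mono: "mono \<phi>"
  proof (rule monoI)
    fix j k :: nat assume "j \<le> k"
    moreover have "k \<le> \<kappa> (LEAST n. k \<le> \<kappa> n)" using ex by (rule LeastI)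
    ultimately show "\<phi> j \<le> \<phi> k" by (auto simp: \<phi>_def intro!: Least_le)
  qed
  have "filterlim \<phi> at_top sequentially"
    unfolding filterlim_at_top eventually_sequentially
    using monoD[OF mono] \<phi>\<kappa> by (metis Suc_leD)
  then obtain \<epsilon> B where e: "0 < \<epsilon>"
    and B: "\<And>k y. y \<in> N k \<Longrightarrow> inverse (real (\<phi> k)) ^ k * (1 / M (\<phi> k) k) * \<epsilon> ^ k * y \<le> B"
    using diag[OF mono] by (auto simp: \<phi>_def)
  \<comment> \<open>This n makes a \<epsilon> at least 1 and a larger than B, where a = n + 1; then
    a (a \<epsilon>)^k, the quantity below, exceeds B for every k.\<close>
  obtain n where n: "max (1 / \<epsilon>) B \<le> real n" using real_arch_simple by blast
  define a where "a = real (Suc n)"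
  define k where "k = \<kappa> n"
  have \<phi>k: "\<phi> k = Suc n" by (simp add: k_def \<phi>\<kappa>)
  define m where "m = M (Suc n) k"
  have a: "0 < a" "1 \<le> a * \<epsilon>" "B < a" using n e by (auto simp: a_def field_simps)
  have m: "0 < m" using weight_pos[OF M] by (simp add: m_def)
  obtain y where y: "y \<in> N k" "a * (a ^ k * a ^ k * m) < y"
    using \<kappa>(1)[of n] unfolding P_def a_def k_def m_def by blast
  have "a \<le> a * (a * \<epsilon>) ^ k" using a one_le_power[OF a(2)] by simp
  also have "\<dots> = inverse a ^ k * (1 / m) * \<epsilon> ^ k * (a * (a ^ k * a ^ k * m))"
    using a m by (simp add: field_simps power_mult_distrib)
  also have "\<dots> \<le> inverse a ^ k * (1 / m) * \<epsilon> ^ k * y"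
    using y(2) a m e by (intro mult_left_mono) auto
  also have "\<dots> \<le> B" using B[OF y(1)] unfolding \<phi>k a_def m_def .
  finally show False using a by simp
qed

section \<open>Derivatives along bounded disks\<close>

lemma bounded_weighted_derivs_iff:
  fixes g :: "'a::real_vector \<Rightarrow> 'b::real_normed_vector"
  assumes w: "\<And>k. 0 < w k"
  shows "bounded (weighted_derivs V p g K w) \<longleftrightarrow>
    (\<exists>B. \<forall>k. \<forall>a\<in>K. \<forall>vs. length vs = k \<and> (\<forall>v\<in>set vs. v \<in> V \<and> p v \<le> 1) \<longrightarrow>
      w k * norm (hderiv g vs a) \<le> B)"
proof -
  have nrm: "norm (w k *\<^sub>R y) = w k * norm y" for k and y :: 'b using w[of k] by simp
  have "(\<forall>x\<in>weighted_derivs V p g K w. norm x \<le> B) \<longleftrightarrow>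
      (\<forall>k. \<forall>a\<in>K. \<forall>vs. length vs = k \<and> (\<forall>v\<in>set vs. v \<in> V \<and> p v \<le> 1) \<longrightarrow>
        norm (w k *\<^sub>R hderiv g vs a) \<le> B)" for B
    unfolding weighted_derivs_def by blast
  then show ?thesis unfolding bounded_iff nrm by simp
qed

section \<open>Derivatives under continuous functionals and restriction to the spaces of bounded
  disks\<close>

lemma smooth_wrt_bounded_multilinear:
  "smooth_wrt V p W g \<Longrightarrow> a \<in> W \<Longrightarrow> bounded_multilinear V p k (\<lambda>vs. hderiv g vs a)"
  by (simp add: smooth_wrt_def)

text \<open>By induction on the directions. The next derivative depends on a neighbourhood of a, so
  the induction hypothesis is used at all points of the open set U.\<close>

lemma hderiv_bounded_linear_comp:
  fixes f :: "'a::real_normed_vector \<Rightarrow> 'b::real_normed_vector"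
    and \<alpha> :: "'b \<Rightarrow> 'c::real_normed_vector"
  assumes f: "smooth_wrt UNIV norm U f" and U: "open U" and \<alpha>: "bounded_linear \<alpha>"
    and a: "a \<in> U"
  shows "hderiv (\<alpha> \<circ> f) vs a = \<alpha> (hderiv f vs a)"
  using a
proof (induction vs arbitrary: a)
  case Nil
  then show ?case by simp
next
  case (Cons v vs)
  have D: "(hderiv f vs has_derivative (\<lambda>v. hderiv f (v # vs) a)) (at a)"
    by (rule smooth_wrt_has_derivative[OF f U Cons.prems])
  have "((\<lambda>x. \<alpha> (hderiv f vs x)) has_derivative (\<lambda>v. \<alpha> (hderiv f (v # vs) a))) (at a)"
    by (rule bounded_linear.has_derivative[OF \<alpha> D])
  then have "(hderiv (\<alpha> \<circ> f) vs has_derivative (\<lambda>v. \<alpha> (hderiv f (v # vs) a))) (at a)"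
    by (rule has_derivative_transform_within_open[OF _ U Cons.prems]) (simp add: Cons.IH)
  then show ?case by (rule hderiv_eq_has_derivative)
qed

lemma prod_list_le_power:
  fixes f :: "'a \<Rightarrow> real"
  assumes "\<And>v. v \<in> set vs \<Longrightarrow> 0 \<le> f v \<and> f v \<le> c"
  shows "0 \<le> (\<Prod>v\<leftarrow>vs. f v) \<and> (\<Prod>v\<leftarrow>vs. f v) \<le> c ^ length vs"
  using assms
proof (induction vs)
  case (Cons v vs)
  then have "f v * (\<Prod>v\<leftarrow>vs. f v) \<le> c * c ^ length vs"
    by (intro mult_mono) (auto intro: order_trans[of 0 "f v" c])
  then show ?case using Cons by simp
qed simp

text \<open>A real supremum is informative only for a nonempty set that is bounded above. The list
  of zeros is a member, and the multilinear estimate gives the bound.\<close>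

lemma multi_norm_nonneg:
  fixes T :: "'a::real_normed_vector list \<Rightarrow> 'b::real_normed_vector"
  assumes T: "bounded_multilinear UNIV norm k T"
  shows "0 \<le> multi_norm UNIV norm k T"
proof -
  obtain C where C: "\<And>vs. length vs = k \<Longrightarrow> norm (T vs) \<le> C * (\<Prod>v\<leftarrow>vs. norm v)"
    using T unfolding bounded_multilinear_def by auto
  have "norm (T vs) \<le> \<bar>C\<bar>" if "length vs = k" "\<forall>v\<in>set vs. norm v \<le> 1" for vs
  proof -
    have "C * (\<Prod>v\<leftarrow>vs. norm v) \<le> \<bar>C\<bar> * 1"
      using prod_list_le_power[of vs norm 1] that by (intro mult_mono) auto
    then show ?thesis using C[OF that(1)] by simp
  qed
  then have "norm (T (replicate k 0)) \<le> multi_norm UNIV norm k T"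
    unfolding multi_norm_def
    by (intro cSup_upper bdd_aboveI[of _ "\<bar>C\<bar>"]) (auto intro!: exI[of _ "replicate k 0"])
  then show ?thesis using norm_ge_zero order_trans by blast
qed

lemma norm_le_multi_norm_unit:
  fixes T :: "'a::real_normed_vector list \<Rightarrow> 'b::real_normed_vector"
  assumes T: "bounded_multilinear UNIV norm k T" and vs: "length vs = k" "\<forall>v\<in>set vs. norm v \<le> c"
  shows "norm (T vs) \<le> multi_norm UNIV norm k T * c ^ k"
proof -
  have "norm (T vs) \<le> multi_norm UNIV norm k T * (\<Prod>v\<leftarrow>vs. norm v)"
    by (rule norm_le_multi_norm[OF T vs(1)])
  also have "\<dots> \<le> multi_norm UNIV norm k T * c ^ k"
    using prod_list_le_power[of vs norm c] vs by (intro mult_left_mono multi_norm_nonneg[OF T]) auto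
  finally show ?thesis .
qed

lemma multi_norm_le:
  assumes B: "bounded_disk B"
    and le: "\<And>vs. length vs = k \<Longrightarrow> (\<forall>v\<in>set vs. v \<in> span B \<and> minkowski B v \<le> 1) \<Longrightarrow> norm (T vs) \<le> c"
  shows "multi_norm (span B) (minkowski B) k T \<le> c"
  unfolding multi_norm_def
proof (rule cSup_least)
  show "{norm (T vs) |vs. length vs = k \<and> (\<forall>v\<in>set vs. v \<in> span B \<and> minkowski B v \<le> 1)} \<noteq> {}"
    using minkowski_zero[OF B] by (auto intro!: exI[of _ "replicate k 0"] simp: span_zero)
qed (use le in auto)

text \<open>The inclusion of \<open>span B\<close> into the ambient space is bounded with some
  constant C. Each of the k arguments costs a factor C, and the functional costs a factor A.\<close>

lemma bounded_multilinear_minkowski: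
  fixes T :: "'a::real_normed_vector list \<Rightarrow> 'b::real_normed_vector"
    and \<alpha> :: "'b \<Rightarrow> 'c::real_normed_vector"
  assumes B: "bounded_disk B" and T: "bounded_multilinear UNIV norm k T" and \<alpha>: "bounded_linear \<alpha>"
  shows "bounded_multilinear (span B) (minkowski B) k (\<lambda>vs. \<alpha> (T vs))"
proof -
  interpret \<alpha>: bounded_linear \<alpha> by (rule \<alpha>)
  obtain C where C: "0 < C" "\<And>v. v \<in> span B \<Longrightarrow> norm v \<le> C * minkowski B v"
    using norm_le_minkowski[OF B] by blast
  obtain D where D: "\<And>vs. length vs = k \<Longrightarrow> norm (T vs) \<le> D * (\<Prod>v\<leftarrow>vs. norm v)"
    using T unfolding bounded_multilinear_def by auto
  obtain A where A: "0 < A" "\<And>x. norm (\<alpha> x) \<le> norm x * A" using \<alpha>.pos_bounded by blast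
  have prod: "0 \<le> (\<Prod>v\<leftarrow>vs. norm v) \<and> (\<Prod>v\<leftarrow>vs. norm v) \<le> C ^ length vs * (\<Prod>v\<leftarrow>vs. minkowski B v)"
    if "set vs \<subseteq> span B" for vs
    using that
  proof (induction vs)
    case (Cons v vs)
    then have "norm v * (\<Prod>v\<leftarrow>vs. norm v)
        \<le> (C * minkowski B v) * (C ^ length vs * (\<Prod>v\<leftarrow>vs. minkowski B v))"
      using C by (intro mult_mono) (auto simp: minkowski_nonneg[OF B])
    then show ?case using Cons by (simp add: mult_ac)
  qed simp
  have "norm (\<alpha> (T vs)) \<le> (\<bar>D\<bar> * C ^ k * A) * (\<Prod>v\<leftarrow>vs. minkowski B v)"
    if vs: "set vs \<subseteq> span B" "length vs = k" for vs
  proof -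
    have "norm (T vs) \<le> D * (\<Prod>v\<leftarrow>vs. norm v)" by (rule D[OF vs(2)])
    also have "\<dots> \<le> \<bar>D\<bar> * (\<Prod>v\<leftarrow>vs. norm v)" using prod[OF vs(1)] by (intro mult_right_mono) auto
    also have "\<dots> \<le> \<bar>D\<bar> * (C ^ k * (\<Prod>v\<leftarrow>vs. minkowski B v))"
      using prod[OF vs(1)] vs(2) by (intro mult_left_mono) auto
    finally have "norm (T vs) * A \<le> \<bar>D\<bar> * (C ^ k * (\<Prod>v\<leftarrow>vs. minkowski B v)) * A"
      using A(1) by (intro mult_right_mono) auto
    then show ?thesis using A(2)[of "T vs"] by (simp add: mult_ac)
  qed
  then show ?thesis using T
    unfolding bounded_multilinear_def by (auto simp: \<alpha>.add \<alpha>.scaleR)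
qed

lemma smooth_wrt_minkowski_comp:
  fixes f :: "'a::real_normed_vector \<Rightarrow> 'b::real_normed_vector"
    and \<alpha> :: "'b \<Rightarrow> 'c::real_normed_vector"
  assumes f: "smooth_wrt UNIV norm U f" and U: "open U" and \<alpha>: "bounded_linear \<alpha>"
    and B: "bounded_disk B"
  shows "smooth_wrt (span B) (minkowski B) (U \<inter> span B) (\<alpha> \<circ> f)"
  unfolding smooth_wrt_def
proof (intro allI ballI conjI impI)
  interpret \<alpha>: bounded_linear \<alpha> by (rule \<alpha>)
  fix k a assume a: "a \<in> U \<inter> span B"
  have comp: "hderiv (\<alpha> \<circ> f) vs x = \<alpha> (hderiv f vs x)" if "x \<in> U" for vs x
    by (rule hderiv_bounded_linear_comp[OF f U \<alpha> that])
  have ml: "bounded_multilinear UNIV norm j (\<lambda>vs. hderiv f vs x)" if "x \<in> U" for j x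
    using smooth_wrt_bounded_multilinear[OF f that] .
  show "bounded_multilinear (span B) (minkowski B) k (\<lambda>vs. hderiv (\<alpha> \<circ> f) vs a)"
    using bounded_multilinear_minkowski[OF B ml \<alpha>] a by (simp add: comp)
  obtain C where C: "0 < C" "\<And>v. v \<in> span B \<Longrightarrow> norm v \<le> C * minkowski B v"
    using norm_le_minkowski[OF B] by blast
  obtain A where A: "0 < A" "\<And>x. norm (\<alpha> x) \<le> norm x * A" using \<alpha>.pos_bounded by blast
  fix \<epsilon> :: real assume \<epsilon>: "0 < \<epsilon>"
  \<comment> \<open>The remainder picks up C^k from its k arguments, one more C from the increment y
    - a, and A from \<alpha>.\<close>
  define \<eta> where "\<eta> = \<epsilon> / (A * C ^ Suc k)"
  have \<eta>: "0 < \<eta>" using \<epsilon> A C by (simp add: \<eta>_def)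
  then obtain \<delta> where \<delta>: "0 < \<delta>" "\<And>y. y \<in> U \<Longrightarrow> norm (y - a) < \<delta> \<Longrightarrow>
      multi_norm UNIV norm k (\<lambda>vs. hderiv f vs y - hderiv f vs a - hderiv f ((y - a) # vs) a)
        \<le> \<eta> * norm (y - a)"
    using f a unfolding smooth_wrt_def by (meson IntD1)
  show "\<exists>\<delta>>0. \<forall>y\<in>U \<inter> span B. minkowski B (y - a) < \<delta> \<longrightarrow>
      multi_norm (span B) (minkowski B) k
        (\<lambda>vs. hderiv (\<alpha> \<circ> f) vs y - hderiv (\<alpha> \<circ> f) vs a - hderiv (\<alpha> \<circ> f) ((y - a) # vs) a)
        \<le> \<epsilon> * minkowski B (y - a)"
  proof (intro exI[of _ "\<delta> / C"] conjI ballI impI)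
    show "0 < \<delta> / C" using \<delta> C by simp
    fix y assume y: "y \<in> U \<inter> span B" "minkowski B (y - a) < \<delta> / C"
    let ?T = "\<lambda>vs. hderiv f vs y - hderiv f vs a - hderiv f ((y - a) # vs) a"
    have ya: "norm (y - a) \<le> C * minkowski B (y - a)" using C(2) y a by (simp add: span_diff)
    also have "\<dots> < \<delta>" using y(2) C(1) by (simp add: field_simps)
    finally have mn: "multi_norm UNIV norm k ?T \<le> \<eta> * norm (y - a)" using \<delta>(2) y by simp
    have mlT: "bounded_multilinear UNIV norm k ?T"
      using y a by (intro bounded_multilinear_diff bounded_multilinear_Cons ml) auto
    show "multi_norm (span B) (minkowski B) k
        (\<lambda>vs. hderiv (\<alpha> \<circ> f) vs y - hderiv (\<alpha> \<circ> f) vs a - hderiv (\<alpha> \<circ> f) ((y - a) # vs) a)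
        \<le> \<epsilon> * minkowski B (y - a)"
    proof (rule multi_norm_le[OF B])
      fix vs assume vs: "length vs = k" "\<forall>v\<in>set vs. v \<in> span B \<and> minkowski B v \<le> 1"
      have "norm v \<le> C" if "v \<in> set vs" for v
      proof -
        have "norm v \<le> C * minkowski B v" using C(2) vs that by blast
        also have "\<dots> \<le> C * 1" using vs that C(1) by (intro mult_left_mono) auto
        finally show ?thesis by simp
      qed
      then have "norm (?T vs) \<le> multi_norm UNIV norm k ?T * C ^ k"
        by (intro norm_le_multi_norm_unit[OF mlT vs(1)]) auto
      also have "\<dots> \<le> (\<eta> * (C * minkowski B (y - a))) * C ^ k"
        using mn ya \<eta> C(1) by (intro mult_right_mono) (auto intro: order_trans)
      finally have "norm (?T vs) * A \<le> (\<eta> * (C * minkowski B (y - a))) * C ^ k * A"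
        using A(1) by (intro mult_right_mono) auto
      also have "\<dots> = \<epsilon> * minkowski B (y - a)" using A C by (simp add: \<eta>_def)
      finally have "norm (\<alpha> (?T vs)) \<le> \<epsilon> * minkowski B (y - a)" using A(2)[of "?T vs"] by simp
      moreover have "hderiv (\<alpha> \<circ> f) vs y - hderiv (\<alpha> \<circ> f) vs a - hderiv (\<alpha> \<circ> f) ((y - a) # vs) a
          = \<alpha> (?T vs)"
        using y a by (simp only: comp IntD1 \<alpha>.diff)
      ultimately show "norm (hderiv (\<alpha> \<circ> f) vs y - hderiv (\<alpha> \<circ> f) vs a - hderiv (\<alpha> \<circ> f) ((y - a) # vs) a)
          \<le> \<epsilon> * minkowski B (y - a)" by (simp only:)
    qed
  qed
qed

text \<open>The inclusion of \<open>span B\<close> is continuous, and continuous images of compact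
  sets are compact: a Minkowski ball of radius e / C lies in the norm ball of radius e.\<close>

lemma compact_if_compactin_minkowski:
  fixes B :: "'a::real_normed_vector set"
  assumes B: "bounded_disk B" and K: "compactin (norm_topology (span B) (minkowski B)) K"
  shows "compact K"
proof -
  interpret Metric_space "span B" "norm_dist (span B) (minkowski B)"
    by (rule Metric_space_minkowski[OF B])
  obtain C where C: "0 < C" "\<And>v. v \<in> span B \<Longrightarrow> norm v \<le> C * minkowski B v"
    using norm_le_minkowski[OF B] by blast
  have "openin mtopology {x \<in> span B. x \<in> V}" if V: "open V" for V
    unfolding openin_mtopology
  proof (intro conjI allI impI)
    fix x assume x: "x \<in> {x \<in> span B. x \<in> V}"
    then obtain e where e: "0 < e" "ball x e \<subseteq> V" using V open_contains_ball by blast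
    have "mball x (e / C) \<subseteq> {x \<in> span B. x \<in> V}"
    proof
      fix y assume y: "y \<in> mball x (e / C)"
      then have "minkowski B (x - y) < e / C" "x - y \<in> span B" "y \<in> span B"
        by (auto simp: norm_dist_def span_diff)
      then have "norm (x - y) < e" using C(2)[of "x - y"] C(1) by (simp add: field_simps)
      then show "y \<in> {x \<in> span B. x \<in> V}"
        using e(2) \<open>y \<in> span B\<close> by (auto simp: dist_norm)
    qed
    then show "\<exists>r>0. mball x r \<subseteq> {x \<in> span B. x \<in> V}" using e(1) C(1) by (intro exI[of _ "e / C"]) simp
  qed auto
  then have "continuous_map mtopology euclidean (\<lambda>x. x)" by (simp add: continuous_map_def)
  then have "compactin euclidean ((\<lambda>x. x) ` K)"
    using K unfolding norm_topology_def by (intro image_compactin)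
  then show ?thesis by simp
qed

section \<open>The closed unit ball as the disk that gives back the space itself\<close>

lemma bounded_disk_cball: "bounded_disk (cball 0 1 :: 'a::real_normed_vector set)"
  by (auto simp: bounded_disk_def mult_le_one)

lemma span_cball: "span (cball 0 1) = (UNIV :: 'a::real_normed_vector set)"
proof -
  have "x \<in> span (cball 0 1)" for x :: 'a
  proof -
    have "norm x *\<^sub>R sgn x \<in> span (cball 0 1)"
      by (intro span_scale span_base) (simp add: norm_sgn)
    moreover have "norm x *\<^sub>R sgn x = x" by (cases "x = 0") (auto simp: sgn_div_norm)
    ultimately show ?thesis by simp
  qed
  then show ?thesis by blast
qed

lemma minkowski_cball_eq_norm: "minkowski (cball 0 1) = (norm :: 'a::real_normed_vector \<Rightarrow> real)"
  by (intro ext minkowski_cball)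

lemma norm_topology_cball:
  "norm_topology (span (cball 0 1)) (minkowski (cball 0 1)) = (euclidean :: 'a::real_normed_vector topology)"
proof -
  have "norm_dist UNIV (minkowski (cball 0 1)) = (dist :: 'a \<Rightarrow> 'a \<Rightarrow> real)"
    by (intro ext) (simp add: norm_dist_def minkowski_cball dist_norm)
  then show ?thesis by (simp add: norm_topology_def span_cball)
qed

section \<open>Comparison of the classes\<close>

text \<open>This is the condition of \<open>Eb_roum\<close> for the closed unit ball alone. It is
  the natural outcome of the diagonal argument, and it implies the condition for every disk.\<close>

definition locally_weighted ::
  "(nat \<Rightarrow> nat \<Rightarrow> real) \<Rightarrow> 'a::real_normed_vector set \<Rightarrow> ('a \<Rightarrow> 'b::real_normed_vector) \<Rightarrow> bool" where
  "locally_weighted M U f \<longleftrightarrow> (\<forall>K. compact K \<and> K \<subseteq> U \<longrightarrow>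
    (\<exists>x>0. \<exists>h>0. bounded (weighted_derivs UNIV norm f K (\<lambda>k. 1 / (h ^ k * M x k)))))"

text \<open>These are the sets \<open>N k\<close> to which the sequence lemmas are applied. Their
  elements are nonnegative, so the one-sided bound in \<open>weighted_bounded\<close> amounts to
  boundedness.\<close>

definition deriv_norms ::
  "('a::real_normed_vector \<Rightarrow> 'b::real_normed_vector) \<Rightarrow> 'a set \<Rightarrow> nat \<Rightarrow> real set" where
  "deriv_norms f K k = {norm (hderiv f vs a) | a vs.
    a \<in> K \<and> length vs = k \<and> (\<forall>v\<in>set vs. norm v \<le> 1)}"

lemma bounded_weighted_derivs_UNIV_iff:
  assumes "\<And>k. 0 < w k"
  shows "bounded (weighted_derivs UNIV norm f K w) \<longleftrightarrow> weighted_bounded (deriv_norms f K) w"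
  unfolding bounded_weighted_derivs_iff[of w, OF assms] weighted_bounded_def deriv_norms_def
  by (intro ex_cong1) blast

text \<open>Sets compact in \<open>span B\<close> are compact in the ambient space, and vectors with
  Minkowski functional at most 1 have norm at most C. Hence the same x works, with C h in place of
  h.\<close>

lemma locally_weighted_imp_Eb_roum:
  fixes f :: "'a::real_normed_vector \<Rightarrow> 'b::real_normed_vector"
  assumes M: "weight_matrix M" and f: "smooth_wrt UNIV norm U f" and lw: "locally_weighted M U f"
  shows "f \<in> Eb_roum M U"
  unfolding Eb_roum_def
proof (intro CollectI conjI f allI impI)
  fix B K
  assume BK: "bounded_disk B \<and> compactin (norm_topology (span B) (minkowski B)) K \<and> K \<subseteq> U \<inter> span B"
  then have B: "bounded_disk B" by blast
  obtain C where C: "0 < C" "\<And>v. v \<in> span B \<Longrightarrow> norm v \<le> C * minkowski B v"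
    using norm_le_minkowski[OF B] by blast
  have "compact K" "K \<subseteq> U" using BK compact_if_compactin_minkowski by auto
  then obtain x h where x: "0 < x" "0 < h"
    and bd: "bounded (weighted_derivs UNIV norm f K (\<lambda>k. 1 / (h ^ k * M x k)))"
    using lw unfolding locally_weighted_def by blast
  have Mp: "0 < M x k" for k using weight_pos[OF M x(1)] .
  then have wp: "0 < 1 / (h ^ k * M x k)" for k using x by simp
  obtain b where b: "\<And>k a vs. a \<in> K \<Longrightarrow> length vs = k \<Longrightarrow> \<forall>v\<in>set vs. norm v \<le> 1 \<Longrightarrow>
      1 / (h ^ k * M x k) * norm (hderiv f vs a) \<le> b"
    using bd unfolding bounded_weighted_derivs_iff[OF wp] by blast
  have "1 / ((C * h) ^ k * M x k) * norm (hderiv f vs a) \<le> \<bar>b\<bar>"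
    if a: "a \<in> K" and vs: "length vs = k" "\<forall>v\<in>set vs. v \<in> span B \<and> minkowski B v \<le> 1" for k a vs
  proof -
    have ml: "bounded_multilinear UNIV norm k (\<lambda>vs. hderiv f vs a)"
      using smooth_wrt_bounded_multilinear[OF f] a \<open>K \<subseteq> U\<close> by blast
    have "norm v \<le> C" if "v \<in> set vs" for v
    proof -
      have "norm v \<le> C * minkowski B v" using C(2) vs that by blast
      also have "\<dots> \<le> C * 1" using vs that C(1) by (intro mult_left_mono) auto
      finally show ?thesis by simp
    qed
    then have "norm (hderiv f vs a) \<le> multi_norm UNIV norm k (\<lambda>vs. hderiv f vs a) * C ^ k"
      by (intro norm_le_multi_norm_unit[OF ml vs(1)]) auto
    \<comment> \<open>The operator norm for \<open>norm\<close> is the one belonging to the disk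
      \<open>cball 0 1\<close>, so the estimate for disks applies to it.\<close>
    also have "multi_norm UNIV norm k (\<lambda>vs. hderiv f vs a) \<le> \<bar>b\<bar> * (h ^ k * M x k)"
    proof -
      have "norm (hderiv f us a) \<le> \<bar>b\<bar> * (h ^ k * M x k)"
        if "length us = k" "\<forall>v\<in>set us. norm v \<le> 1" for us
      proof -
        have "1 / (h ^ k * M x k) * norm (hderiv f us a) \<le> \<bar>b\<bar>" using b[OF a that] by linarith
        then show ?thesis using x Mp[of k] by (simp add: field_simps)
      qed
      then show ?thesis
        using multi_norm_le[OF bounded_disk_cball, of k "\<lambda>vs. hderiv f vs a"]
        by (simp add: span_cball minkowski_cball_eq_norm)
    qed
    finally have "norm (hderiv f vs a) \<le> \<bar>b\<bar> * (h ^ k * M x k) * C ^ k"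
      using C(1) by simp
    then show ?thesis using x Mp[of k] C(1) by (simp add: field_simps power_mult_distrib)
  qed
  moreover have wpC: "0 < 1 / ((C * h) ^ k * M x k)" for k using x Mp C(1) by simp
  ultimately have "bounded (weighted_derivs (span B) (minkowski B) f K (\<lambda>k. 1 / ((C * h) ^ k * M x k)))"
    unfolding bounded_weighted_derivs_iff[OF wpC] by blast
  then show "\<exists>x>0. \<exists>h>0. bounded
      (weighted_derivs (span B) (minkowski B) f K (\<lambda>k. 1 / (h ^ k * M x k)))"
    using x C(1) by (meson mult_pos_pos)
qed

text \<open>A functional commutes with differentiation and costs one factor A, the same for all k; x
  and h are unchanged.\<close>

lemma Eb_roum_subset_E_roum:
  fixes U :: "'a::real_normed_vector set"
  assumes M: "weight_matrix M" and U: "open U"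
  shows "(Eb_roum M U :: ('a \<Rightarrow> 'b::real_normed_vector) set) \<subseteq> E_roum M U"
proof
  fix f :: "'a \<Rightarrow> 'b" assume Eb: "f \<in> Eb_roum M U"
  then have f: "smooth_wrt UNIV norm U f" by (simp add: Eb_roum_def)
  show "f \<in> E_roum M U"
    unfolding E_roum_def E_roum_real_def
  proof (intro CollectI conjI f allI impI)
    fix \<alpha> :: "'b \<Rightarrow> real" and B :: "'a set" assume aB: "bounded_linear \<alpha> \<and> bounded_disk B"
    then show "smooth_wrt (span B) (minkowski B) (U \<inter> span B) (\<alpha> \<circ> f)"
      by (intro smooth_wrt_minkowski_comp[OF f U]) auto
    fix K assume K: "compactin (norm_topology (span B) (minkowski B)) K \<and> K \<subseteq> U \<inter> span B"
    then obtain x h where x: "0 < x" "0 < h" and bd: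
      "bounded (weighted_derivs (span B) (minkowski B) f K (\<lambda>k. 1 / (h ^ k * M x k)))"
      using Eb aB unfolding Eb_roum_def by blast
    have Mp: "0 < M x k" for k using weight_pos[OF M x(1)] .
    then have wp: "0 < 1 / (h ^ k * M x k)" for k using x by simp
    obtain b where b: "\<And>k a vs. a \<in> K \<Longrightarrow> length vs = k \<Longrightarrow>
        \<forall>v\<in>set vs. v \<in> span B \<and> minkowski B v \<le> 1 \<Longrightarrow> 1 / (h ^ k * M x k) * norm (hderiv f vs a) \<le> b"
      using bd unfolding bounded_weighted_derivs_iff[OF wp] by blast
    obtain A where A: "0 < A" "\<And>x. norm (\<alpha> x) \<le> norm x * A"
      using aB bounded_linear.pos_bounded by blast
    have "multi_norm (span B) (minkowski B) k (\<lambda>vs. hderiv (\<alpha> \<circ> f) vs a) \<le> b * A * (h ^ k * M x k)"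
      if a: "a \<in> K" for k a
    proof (rule multi_norm_le)
      fix vs assume vs: "length vs = k" "\<forall>v\<in>set vs. v \<in> span B \<and> minkowski B v \<le> 1"
      have "norm (hderiv f vs a) \<le> b * (h ^ k * M x k)"
        using b[OF a vs] x Mp[of k] by (simp add: field_simps)
      then have "norm (hderiv f vs a) * A \<le> b * (h ^ k * M x k) * A"
        using A(1) by (intro mult_right_mono) auto
      moreover have "hderiv (\<alpha> \<circ> f) vs a = \<alpha> (hderiv f vs a)"
        using a K aB by (intro hderiv_bounded_linear_comp[OF f U]) auto
      ultimately show "norm (hderiv (\<alpha> \<circ> f) vs a) \<le> b * A * (h ^ k * M x k)"
        using A(2)[of "hderiv f vs a"] by (simp add: mult_ac)
    qed (use aB in blast)
    then have "multi_norm (span B) (minkowski B) k (\<lambda>vs. hderiv (\<alpha> \<circ> f) vs a) / (h ^ k * M x k) \<le> b * A"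
      if "a \<in> K" for k a
      using that x Mp[of k] by (simp add: field_simps)
    then have "bdd_above {multi_norm (span B) (minkowski B) k (\<lambda>vs. hderiv (\<alpha> \<circ> f) vs a)
        / (h ^ k * M x k) | k a. a \<in> K}"
      by (intro bdd_aboveI[of _ "b * A"]) auto
    then show "\<exists>x>0. \<exists>h>0. bdd_above {multi_norm (span B) (minkowski B) k
        (\<lambda>vs. hderiv (\<alpha> \<circ> f) vs a) / (h ^ k * M x k) | k a. a \<in> K}"
      using x by blast
  qed
qed

lemma E_roum_imp_bounded_R_S:
  fixes f :: "'a::real_normed_vector \<Rightarrow> 'b::real_normed_vector"
  assumes M: "weight_matrix M" and U: "open U" and f: "f \<in> E_roum M U"
    and K: "compact K" "K \<subseteq> U" and r: "r \<in> R_roum" and s: "s \<in> S_roum M"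
  shows "bounded (weighted_derivs UNIV norm f K (\<lambda>k. r k * s k))"
proof (rule weakly_bounded_imp_bounded)
  fix \<alpha> :: "'b \<Rightarrow> real" assume \<alpha>: "bounded_linear \<alpha>"
  have sm: "smooth_wrt UNIV norm U f" using f by (simp add: E_roum_def)
  have rs: "0 < r k * s k" for k using r s by (simp add: R_roum_def S_roum_def)
  \<comment> \<open>The definition is used for the closed unit ball, where \<open>span B\<close>,
    the Minkowski functional and the topology are those of the original space.\<close>
  have "\<alpha> \<circ> f \<in> E_roum_real M (span (cball 0 1)) (minkowski (cball 0 1)) (U \<inter> span (cball 0 1))"
    using f \<alpha> bounded_disk_cball unfolding E_roum_def by blast
  then have sm\<alpha>: "smooth_wrt UNIV norm U (\<alpha> \<circ> f)" and
    "\<exists>x>0. \<exists>h>0. bdd_above {multi_norm UNIV norm k (\<lambda>vs. hderiv (\<alpha> \<circ> f) vs a) / (h ^ k * M x k) | k a. a \<in> K}"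
    using K norm_topology_cball[where 'a='a] unfolding E_roum_real_def by (simp_all add: span_cball minkowski_cball_eq_norm)
  then obtain x h b where x: "0 < x" "0 < h" and
    b: "\<And>k a. a \<in> K \<Longrightarrow> multi_norm UNIV norm k (\<lambda>vs. hderiv (\<alpha> \<circ> f) vs a) / (h ^ k * M x k) \<le> b"
    unfolding bdd_above_def by blast
  have Mp: "0 < M x k" for k using weight_pos[OF M x(1)] .
  have "weighted_bounded (deriv_norms (\<alpha> \<circ> f) K) (\<lambda>k. 1 / (h ^ k * M x k))"
    unfolding weighted_bounded_def
  proof (intro exI allI ballI)
    fix k y assume "y \<in> deriv_norms (\<alpha> \<circ> f) K k"
    then obtain a vs where y: "y = norm (hderiv (\<alpha> \<circ> f) vs a)"
      and a: "a \<in> K" and vs: "length vs = k" "\<forall>v\<in>set vs. norm v \<le> 1"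
      unfolding deriv_norms_def by blast
    have "bounded_multilinear UNIV norm k (\<lambda>vs. hderiv (\<alpha> \<circ> f) vs a)"
      using smooth_wrt_bounded_multilinear[OF sm\<alpha>] a K by blast
    from norm_le_multi_norm_unit[OF this vs] b[OF a, of k]
    show "1 / (h ^ k * M x k) * y \<le> b" using x Mp[of k] by (simp add: y field_simps)
  qed
  \<comment> \<open>Here x and h, which depend on \<alpha>, disappear: the weights r k * s k are the
    same for all functionals, as the weak boundedness criterion requires.\<close>
  then have "weighted_bounded (deriv_norms (\<alpha> \<circ> f) K) (\<lambda>k. r k * s k)"
    by (rule weighted_bounded_R_S[OF M x _ r s])
  then have "bounded (weighted_derivs UNIV norm (\<alpha> \<circ> f) K (\<lambda>k. r k * s k))"
    using rs by (subst bounded_weighted_derivs_UNIV_iff) auto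
  moreover have "\<alpha> ` weighted_derivs UNIV norm f K (\<lambda>k. r k * s k)
      \<subseteq> weighted_derivs UNIV norm (\<alpha> \<circ> f) K (\<lambda>k. r k * s k)"
  proof
    fix z assume "z \<in> \<alpha> ` weighted_derivs UNIV norm f K (\<lambda>k. r k * s k)"
    then obtain a k vs where z: "z = \<alpha> ((r k * s k) *\<^sub>R hderiv f vs a)"
      and a: "a \<in> K" and vs: "length vs = k" "\<forall>v\<in>set vs. norm v \<le> 1"
      unfolding weighted_derivs_def by auto
    have "z = (r k * s k) *\<^sub>R hderiv (\<alpha> \<circ> f) vs a"
      using hderiv_bounded_linear_comp[OF sm U \<alpha>, of a vs] a K
      by (auto simp: z linear_simps(5)[OF \<alpha>])
    then show "z \<in> weighted_derivs UNIV norm (\<alpha> \<circ> f) K (\<lambda>k. r k * s k)"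
      using a vs unfolding weighted_derivs_def by blast
  qed
  ultimately show "bounded (\<alpha> ` weighted_derivs UNIV norm f K (\<lambda>k. r k * s k))"
    by (rule bounded_subset)
qed

lemma locally_weighted_of_R_S:
  assumes M: "weight_matrix M" and "S \<subseteq> S_roum M"
    and S: "\<And>\<phi>. mono \<phi> \<Longrightarrow> (\<And>k. 0 < \<phi> k) \<Longrightarrow> filterlim \<phi> at_top sequentially \<Longrightarrow>
      (\<lambda>k. 1 / M (\<phi> k) k) \<in> S"
    and bd: "\<forall>K r s. compact K \<and> K \<subseteq> U \<and> r \<in> R_roum_sub \<and> s \<in> S \<longrightarrow>
      (\<exists>\<epsilon>>0. bounded (weighted_derivs UNIV norm f K (\<lambda>k. r k * s k * \<epsilon> ^ k)))"
  shows "locally_weighted M U f"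
  unfolding locally_weighted_def
proof (intro allI impI)
  fix K assume K: "compact K \<and> K \<subseteq> U"
  have "\<exists>x>0. \<exists>h>0. weighted_bounded (deriv_norms f K) (\<lambda>k. 1 / (h ^ k * M x k))"
  proof (rule weighted_bounded_of_R_S[OF M S])
    fix r s assume r: "r \<in> R_roum_sub" and s: "s \<in> S"
    have rs: "0 < r k" "0 < s k" for k
      using r s \<open>S \<subseteq> S_roum M\<close> by (auto simp: R_roum_sub_def R_roum_def S_roum_def)
    obtain \<epsilon> where \<epsilon>: "0 < \<epsilon>" "bounded (weighted_derivs UNIV norm f K (\<lambda>k. r k * s k * \<epsilon> ^ k))"
      using bd K r s by blast
    then have "weighted_bounded (deriv_norms f K) (\<lambda>k. r k * s k * \<epsilon> ^ k)"
      using rs by (subst (asm) bounded_weighted_derivs_UNIV_iff) auto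
    then show "\<exists>\<epsilon>>0. weighted_bounded (deriv_norms f K) (\<lambda>k. r k * s k * \<epsilon> ^ k)" using \<epsilon>(1) by blast
  qed
  then obtain x h where x: "0 < x" "0 < h"
    "weighted_bounded (deriv_norms f K) (\<lambda>k. 1 / (h ^ k * M x k))" by blast
  then have "bounded (weighted_derivs UNIV norm f K (\<lambda>k. 1 / (h ^ k * M x k)))"
    using weight_pos[OF M x(1)] by (subst bounded_weighted_derivs_UNIV_iff) auto
  then show "\<exists>x>0. \<exists>h>0. bounded (weighted_derivs UNIV norm f K (\<lambda>k. 1 / (h ^ k * M x k)))"
    using x by blast
qed

text \<open>Both versions of the theorem are proved at once. The family S in condition (3) may be
  anything inside \<open>S_roum M\<close> that contains the diagonal sequences. The implications run
  in a circle from \<open>E_roum\<close> through (2), (3) and \<open>Eb_roum\<close> back to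
  \<open>E_roum\<close>.\<close>

lemma E_roum_equivalences:
  assumes M: "weight_matrix M" and U: "open U" and f: "smooth_wrt UNIV norm U f"
    and SM: "S \<subseteq> S_roum M"
    and S: "\<And>\<phi>. mono \<phi> \<Longrightarrow> (\<And>k. 0 < \<phi> k) \<Longrightarrow> filterlim \<phi> at_top sequentially \<Longrightarrow>
      (\<lambda>k. 1 / M (\<phi> k) k) \<in> S"
  shows "(f \<in> E_roum M U \<longleftrightarrow> f \<in> Eb_roum M U) \<and>
      (f \<in> E_roum M U \<longleftrightarrow>
        (\<forall>K r s. compact K \<and> K \<subseteq> U \<and> r \<in> R_roum \<and> s \<in> S_roum M \<longrightarrow>
          bounded (weighted_derivs UNIV norm f K (\<lambda>k. r k * s k)))) \<and>
      (f \<in> E_roum M U \<longleftrightarrow>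
        (\<forall>K r s. compact K \<and> K \<subseteq> U \<and> r \<in> R_roum_sub \<and> s \<in> S \<longrightarrow>
          (\<exists>\<epsilon>>0. bounded (weighted_derivs UNIV norm f K (\<lambda>k. r k * s k * \<epsilon> ^ k)))))"
    (is "(?E \<longleftrightarrow> ?Eb) \<and> (?E \<longleftrightarrow> ?two) \<and> (?E \<longleftrightarrow> ?three)")
proof -
  have "?E \<Longrightarrow> ?two" using E_roum_imp_bounded_R_S[OF M U] by blast
  moreover have "?two \<Longrightarrow> ?three"
  proof (intro allI impI)
    fix K r s assume two: ?two and "compact K \<and> K \<subseteq> U \<and> r \<in> R_roum_sub \<and> s \<in> S"
    then have "compact K \<and> K \<subseteq> U \<and> r \<in> R_roum \<and> s \<in> S_roum M"
      using SM by (auto simp: R_roum_sub_def)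
    \<comment> \<open>Condition (2) gives (3) with \<epsilon> = 1.\<close>
    then have "bounded (weighted_derivs UNIV norm f K (\<lambda>k. r k * s k * 1 ^ k))" using two by simp
    then show "\<exists>\<epsilon>>0. bounded (weighted_derivs UNIV norm f K (\<lambda>k. r k * s k * \<epsilon> ^ k))"
      using zero_less_one by blast
  qed
  moreover have "?three \<Longrightarrow> ?Eb"
    using locally_weighted_imp_Eb_roum[OF M f] locally_weighted_of_R_S[OF M SM S] by blast
  moreover have "?Eb \<Longrightarrow> ?E" using Eb_roum_subset_E_roum[OF M U] by blast
  ultimately show ?thesis by argo
qed

theorem proposition4p7:
  fixes M :: "nat \<Rightarrow> nat \<Rightarrow> real"
    and U :: "'e::banach set"
    and f :: "'e \<Rightarrow> 'f::banach"
  assumes "open U" and "smooth_wrt UNIV norm U f"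
  shows "(standard_log_convex M \<longrightarrow>
      (f \<in> E_roum M U \<longleftrightarrow> f \<in> Eb_roum M U) \<and>
      (f \<in> E_roum M U \<longleftrightarrow>
        (\<forall>K r s. compact K \<and> K \<subseteq> U \<and> r \<in> R_roum \<and> s \<in> S_roum M \<longrightarrow>
          bounded (weighted_derivs UNIV norm f K (\<lambda>k. r k * s k)))) \<and>
      (f \<in> E_roum M U \<longleftrightarrow>
        (\<forall>K r s. compact K \<and> K \<subseteq> U \<and> r \<in> R_roum_sub \<and> s \<in> S_roum_sub M \<longrightarrow>
          (\<exists>\<epsilon>>0. bounded (weighted_derivs UNIV norm f K (\<lambda>k. r k * s k * \<epsilon> ^ k)))))) \<and>
    (weight_matrix M \<longrightarrow>
      (f \<in> E_roum M U \<longleftrightarrow> f \<in> Eb_roum M U) \<and>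
      (f \<in> E_roum M U \<longleftrightarrow>
        (\<forall>K r s. compact K \<and> K \<subseteq> U \<and> r \<in> R_roum \<and> s \<in> S_roum M \<longrightarrow>
          bounded (weighted_derivs UNIV norm f K (\<lambda>k. r k * s k)))) \<and>
      (f \<in> E_roum M U \<longleftrightarrow>
        (\<forall>K r s. compact K \<and> K \<subseteq> U \<and> r \<in> R_roum_sub \<and> s \<in> S_roum M \<longrightarrow>
          (\<exists>\<epsilon>>0. bounded (weighted_derivs UNIV norm f K (\<lambda>k. r k * s k * \<epsilon> ^ k))))))"
  (is "(_ \<longrightarrow> ?standard) \<and> (_ \<longrightarrow> ?general)")
proof (rule conjI; rule impI)
  assume M: "standard_log_convex M"
  then have W: "weight_matrix M" by (simp add: standard_log_convex_def)
  have "S_roum_sub M \<subseteq> S_roum M" by (auto simp: S_roum_sub_def)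
  then show ?standard
    by (rule E_roum_equivalences[OF W assms]) (rule diagonal_in_S_roum_sub[OF M])
next
  assume M: "weight_matrix M"
  show ?general
    by (rule E_roum_equivalences[OF M assms order_refl]) (rule diagonal_in_S_roum[OF M])
qed

end
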